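(* Let $p$ be a prime, let $M,\tilde M\in M_n(\mathbb{Z})$ be expanding integer matrices, and let $D,\tilde D\subset\mathbb{Z}^n$ be finite digit sets. Suppose that $(M,D)$ and $(\tilde M,\tilde D)$ are conjugate in $GL_n(p)$, and that $\mathcal{Z}_{\tilde D}^n\subset\mathring{E}_p^n$ or $\mathcal{Z}_{D}^n\subset\mathring{E}_p^n$. Then $L^2(\mu_{M,D})$ has infinitely many mutually orthogonal exponential functions (i.e. there is an infinite $\Lambda\subset\mathbb{R}^n$ with $E(\Lambda)$ an orthogonal set in $L^2(\mu_{M,D})$) if and only if $L^2(\mu_{\tilde M,\tilde D})$ has infinitely many mutually orthogonal exponential functions. Moreover, if $\det(M)\notin p\mathbb{Z}$, then $n^*(\mu_{M,D})=n^*(\mu_{\tilde M,\tilde D})\le p^n$.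
   Context: A matrix is expanding if all its eigenvalues have modulus $>1$. Self-affine measure: for an expanding matrix $M\in M_n(\mathbb{R})$ and a finite digit set $D\subset\mathbb{R}^n$, $\mu_{M,D}$ is the unique Borel probability measure $\mu$ on $\mathbb{R}^n$ with $\mu=\frac{1}{|D|}\sum_{d\in D}\mu\circ\phi_d^{-1}$, where $\phi_d(x)=M^{-1}(x+d)$. For finite or countable $\Lambda\subset\mathbb{R}^n$, $E(\Lambda):=\{e^{2\pi i\langle\lambda,x\rangle}:\lambda\in\Lambda\}$. For a compactly supported Borel probability measure $\mu$ on $\mathbb{R}^n$, $n^*(\mu):=\sup\{|\Lambda|: E(\Lambda)\text{ is a maximal orthogonal set of exponential functions in }L^2(\mu)\}$. Conjugacy: $(M,D)$ and $(\tilde M,\tilde D)$ are conjugate in $GL_n(p)$ (through $A,B$) if there exist two integer matrices $A,B\in M_n(\mathbb{Z})$, whose reductions mod $p$ are invertible, with $AB\equiv I\pmod p$, such that one of the following holds: (i) $\tilde M=AMB$ and $D=B\tilde D$; (ii) $\tilde M=AMB$ and $\tilde D=AD$. Mask polynomial: $m_D(x)=\frac{1}{|D|}\sum_{d\in D}e^{2\pi i\langle d,x\rangle}$ for $x\in\mathbb{R}^n$; $\mathcal{Z}(m_D)=\{x\in\mathbb{R}^n: m_D(x)=0\}$; $\mathcal{Z}_D^n:=\mathcal{Z}(m_D)\cap[0,1)^n$. For an integer $q\ge2$: $E_q^n:=\frac1q\{(l_1,\dots,l_n)^t: l_i\in\mathbb{Z},\ 0\le l_1,\dots,l_n\le q-1\}$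 and $\mathring{E}_q^n:=E_q^n\setminus\{0\}$. *)

theory Defs
  imports
    "HOL-Probability.Probability"
    "HOL-Number_Theory.Cong"
    "HOL-Library.Extended_Nat"
begin

section \<open>Integer vectors and matrices\<close>

abbreviation real_vec :: "int ^ 'n \<Rightarrow> real ^ 'n" where
  "real_vec v \<equiv> (\<chi> i. of_int (v $ i))"

abbreviation real_mat :: "int ^ 'n ^ 'm \<Rightarrow> real ^ 'n ^ 'm" where
  "real_mat M \<equiv> map_matrix of_int M"

definition mat_cong :: "nat \<Rightarrow> int ^ 'n ^ 'm \<Rightarrow> int ^ 'n ^ 'm \<Rightarrow> bool" where
  "mat_cong p A B \<longleftrightarrow> (\<forall>i j. [A $ i $ j = B $ i $ j] (mod int p))"

definition invertible_mod :: "nat \<Rightarrow> int ^ 'n ^ 'n \<Rightarrow> bool" where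
  "invertible_mod p A \<longleftrightarrow>
     (\<exists>C :: int ^ 'n ^ 'n. mat_cong p (A ** C) (mat 1) \<and> mat_cong p (C ** A) (mat 1))"

definition conjugate_GL ::
  "nat \<Rightarrow> int ^ 'n ^ 'n \<Rightarrow> (int ^ 'n) set \<Rightarrow> int ^ 'n ^ 'n \<Rightarrow> (int ^ 'n) set \<Rightarrow> bool" where
  "conjugate_GL p M D M' D' \<longleftrightarrow>
     (\<exists>A B :: int ^ 'n ^ 'n.
        invertible_mod p A \<and> invertible_mod p B \<and> mat_cong p (A ** B) (mat 1) \<and>
        ((M' = A ** M ** B \<and> D = (\<lambda>d. B *v d) ` D') \<or>
         (M' = A ** M ** B \<and> D' = (\<lambda>d. A *v d) ` D)))"

section \<open>Expanding matrices and self-affine measures\<close>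

text \<open>The eigenvalues of a real matrix are its complex ones.\<close>

definition eigenvalue_of :: "real ^ 'n ^ 'n \<Rightarrow> complex \<Rightarrow> bool" where
  "eigenvalue_of M c \<longleftrightarrow>
     (\<exists>v :: complex ^ 'n. v \<noteq> 0 \<and> map_matrix complex_of_real M *v v = c *s v)"

definition expanding :: "real ^ 'n ^ 'n \<Rightarrow> bool" where
  "expanding M \<longleftrightarrow> (\<forall>c. eigenvalue_of M c \<longrightarrow> cmod c > 1)"

definition ifs_map :: "real ^ 'n ^ 'n \<Rightarrow> real ^ 'n \<Rightarrow> real ^ 'n \<Rightarrow> real ^ 'n" where
  "ifs_map M d x = matrix_inv M *v (x + d)"

definition is_self_affine_measure ::
  "real ^ 'n ^ 'n \<Rightarrow> (real ^ 'n) set \<Rightarrow> (real ^ 'n) measure \<Rightarrow> bool" where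
  "is_self_affine_measure M D \<mu> \<longleftrightarrow>
     prob_space \<mu> \<and> sets \<mu> = sets borel \<and>
     (\<forall>S \<in> sets borel.
        measure \<mu> S = 1 / real (card D) * (\<Sum>d\<in>D. measure \<mu> (ifs_map M d -` S)))"

text \<open>Existence and uniqueness hold when \<open>M\<close> is expanding and \<open>D\<close> is finite and nonempty.\<close>

definition self_affine_measure ::
  "real ^ 'n ^ 'n \<Rightarrow> (real ^ 'n) set \<Rightarrow> (real ^ 'n) measure" where
  "self_affine_measure M D = (THE \<mu>. is_self_affine_measure M D \<mu>)"

section \<open>Orthogonal exponentials\<close>

definition expo :: "real ^ 'n \<Rightarrow> real ^ 'n \<Rightarrow> complex" where
  "expo l x = exp (2 * pi * \<i> * complex_of_real (l \<bullet> x))"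

definition E :: "(real ^ 'n) set \<Rightarrow> (real ^ 'n \<Rightarrow> complex) set" where
  "E \<Lambda> = expo ` \<Lambda>"

text \<open>
  Elements of \<open>F\<close> are compared as functions, not modulo equality almost everywhere, so
  distinct frequencies give distinct elements of \<open>E \<Lambda>\<close>, and these must be orthogonal.
  The definition is only used for sets of exponentials, which lie in \<open>L\<^sup>2(\<mu>)\<close>
  for every Borel probability measure \<open>\<mu>\<close>.
\<close>

definition orthogonal_set ::
  "(real ^ 'n) measure \<Rightarrow> (real ^ 'n \<Rightarrow> complex) set \<Rightarrow> bool" where
  "orthogonal_set \<mu> F \<longleftrightarrow>
     (\<forall>f\<in>F. \<forall>g\<in>F. f \<noteq> g \<longrightarrow> (LINT x|\<mu>. f x * cnj (g x)) = 0)"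

definition maximal_orthogonal_exponentials ::
  "(real ^ 'n) measure \<Rightarrow> (real ^ 'n) set \<Rightarrow> bool" where
  "maximal_orthogonal_exponentials \<mu> \<Lambda> \<longleftrightarrow>
     orthogonal_set \<mu> (E \<Lambda>) \<and>
     (\<forall>\<Lambda>'. \<Lambda> \<subseteq> \<Lambda>' \<and> orthogonal_set \<mu> (E \<Lambda>') \<longrightarrow> \<Lambda>' = \<Lambda>)"

definition ecard :: "'a set \<Rightarrow> enat" where
  "ecard A = (if finite A then enat (card A) else \<infinity>)"

definition n_star :: "(real ^ 'n) measure \<Rightarrow> enat" where
  "n_star \<mu> =
     Sup {ecard \<Lambda> | \<Lambda>. countable \<Lambda> \<and> maximal_orthogonal_exponentials \<mu> \<Lambda>}"

definition has_infinite_orthogonal_exponentials :: "(real ^ 'n) measure \<Rightarrow> bool" where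
  "has_infinite_orthogonal_exponentials \<mu> \<longleftrightarrow>
     (\<exists>\<Lambda>. infinite \<Lambda> \<and> countable \<Lambda> \<and> orthogonal_set \<mu> (E \<Lambda>))"

section \<open>Mask polynomials and their zeros\<close>

definition mask :: "(real ^ 'n) set \<Rightarrow> real ^ 'n \<Rightarrow> complex" where
  "mask D x = 1 / of_nat (card D) * (\<Sum>d\<in>D. expo d x)"

definition mask_zeros :: "(real ^ 'n) set \<Rightarrow> (real ^ 'n) set" where
  "mask_zeros D = {x. mask D x = 0} \<inter> {x. \<forall>i. 0 \<le> x $ i \<and> x $ i < 1}"

definition E_grid :: "nat \<Rightarrow> (real ^ 'n) set" where
  "E_grid q = {(1 / real q) *\<^sub>R real_vec l | l :: int ^ 'n. \<forall>i. 0 \<le> l $ i \<and> l $ i \<le> int q - 1}"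

definition E_grid_punctured :: "nat \<Rightarrow> (real ^ 'n) set" where
  "E_grid_punctured q = E_grid q - {0}"

end

theory Submission
  imports Defs "HOL-Computational_Algebra.Fundamental_Theorem_Algebra"
begin

text \<open>
  Write \<open>\<mu>\<close> for the self-affine measure of \<open>(M, D)\<close> and \<open>\<mu>'\<close> for that of \<open>(M', D')\<close>.
  The exponentials with frequencies \<open>l \<noteq> l'\<close> are orthogonal in \<open>L\<^sup>2(\<mu>)\<close> iff the Fourier
  transform of \<open>\<mu>\<close> vanishes at \<open>l - l'\<close>. Self-affinity turns into the functional equation
  \<open>fourier \<mu> l = mask D (M\<^sup>-\<^sup>T l) * fourier \<mu> (M\<^sup>-\<^sup>T l)\<close>. As \<open>M\<close> is expanding, the arguments
  shrink to 0 where the transform is 1, so the zero set of the transform is the union of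
  the images \<open>(M\<^sup>T)\<^sup>j Z\<close>, \<open>j \<ge> 1\<close>, of the zero set \<open>Z\<close> of the mask (\<open>fourier_zero_iff\<close>). This needs
  \<open>M\<^sup>-\<^sup>k x \<rightarrow> 0\<close>, which is proved by factoring a polynomial that annihilates the orbit of \<open>x\<close>
  (\<open>expanding_imp_summable_inverse_orbit\<close>). It also needs that the measure exists
  and is unique (\<open>self_affine_measure_is_self_affine\<close>): it is the law of the random series
  \<open>\<Sum>k. M\<^sup>-\<^sup>k\<^sup>-\<^sup>1 d\<^sub>k\<close> with independent uniform digits, and averaging a Lipschitz function over digit
  words flattens it to a constant that determines its integral.

  The rest is arithmetic modulo \<open>p\<close>. Suppose that \<open>D\<close> is the image of \<open>D'\<close> under \<open>B\<close>. Then the mask of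
  \<open>D\<close> is that of \<open>D'\<close> composed with \<open>B\<^sup>T\<close>, and the grid hypothesis, which can be
  moved from \<open>D\<close> to \<open>D'\<close> (\<open>mask_zeros_subset_grid_transfer\<close>), says that the zeros of the mask of
  \<open>D'\<close> are the points \<open>s / p\<close> for \<open>s\<close> in a set \<open>S\<close> of integer vectors, which is a union of
  residue classes modulo \<open>p\<close> and omits the class of 0. After scaling by an integer that clears
  denominators, an orthogonal set of frequencies becomes a set of integer vectors whose
  differences are congruent to vectors \<open>(M\<^sup>T)\<^sup>j A\<^sup>T s\<close> with \<open>s \<in> S\<close>; call it a clique
  (\<open>orthogonal_imp_clique\<close>). There are only \<open>p ^ n\<close> residues, so
  an infinite clique has two congruent elements, and then some \<open>(M\<^sup>T)\<^sup>j A\<^sup>T s\<close> is 0 modulo \<open>p\<close>.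
  Conversely such a nilpotent digit \<open>s\<close> yields the infinite orthogonal set of partial
  sums of \<open>\<Sum>r. (M\<^sup>T)\<^sup>K\<^sup>r A\<^sup>T s\<close>, multiplied by \<open>M\<^sup>T / p\<close> (\<open>nilpotent_imp_infinite\<close>). If \<open>p\<close> does not divide
  \<open>det M\<close>, there is no nilpotent digit, cliques have at most \<open>p ^ n\<close> elements, and
  periodicity of the powers of \<open>M\<^sup>T\<close> modulo \<open>p\<close> lifts every clique back to an orthogonal set, so
  \<open>n_star\<close> is the largest size of a clique (\<open>n_star_eq_clique_number\<close>).

  Both criteria involve only residues modulo \<open>p\<close>, where \<open>A\<^sup>T\<close> intertwines
  \<open>M'\<^sup>T\<close> with \<open>M\<^sup>T\<close>; hence they agree for the two pairs (\<open>conjugate_measures\<close>). The second form of conjugacy is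
  the first one with the two pairs exchanged, because modulo \<open>p\<close> also \<open>M\<close> is \<open>B M' A\<close>.
\<close>

section \<open>Orbits under the inverse of an expanding matrix\<close>

text \<open>
  A discrete Gronwall bound: all partial sums stay below the fixed point of \<open>x \<mapsto> a 0 +
  c * x + suminf e\<close>.
\<close>

lemma summable_of_contractive_recurrence:
  fixes a e :: "nat \<Rightarrow> real"
  assumes "0 \<le> c" "c < 1" and nonneg: "\<And>k. 0 \<le> a k" "\<And>k. 0 \<le> e k"
    and rec: "\<And>k. a (Suc k) \<le> c * a k + e k" and "summable e"
  shows "summable a"
proof -
  define K where "K = (a 0 + suminf e) / (1 - c)"
  have K: "a 0 + c * K + suminf e = K"
    using \<open>c < 1\<close> by (simp add: K_def field_simps)
  have K0: "0 \<le> K"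
    using assms by (auto simp: K_def intro!: divide_nonneg_nonneg add_nonneg_nonneg suminf_nonneg)
  have "(\<Sum>k<n. a k) \<le> K" for n
  proof (induction n)
    case (Suc n)
    have "(\<Sum>k<Suc n. a k) = a 0 + (\<Sum>k<n. a (Suc k))"
      by (rule sum.lessThan_Suc_shift)
    also have "\<dots> \<le> a 0 + (\<Sum>k<n. c * a k + e k)"
      by (intro add_left_mono sum_mono rec)
    also have "\<dots> = a 0 + c * (\<Sum>k<n. a k) + (\<Sum>k<n. e k)"
      by (simp add: sum.distrib sum_distrib_left)
    also have "\<dots> \<le> a 0 + c * K + suminf e"
      using Suc \<open>0 \<le> c\<close> nonneg \<open>summable e\<close>
      by (intro add_mono mult_left_mono sum_le_suminf) auto
    finally show ?case using K by simp
  qed (use K0 in simp)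
  then show ?thesis
    by (intro summableI_nonneg_bounded nonneg)
qed

lemma norm_vector_scalar_mult: "norm (c *s v) = cmod c * norm (v :: complex ^ 'n)"
  by (simp add: norm_vec_def norm_mult L2_set_right_distrib)

lemma funpow_matrix_vector_diff:
  fixes A :: "complex ^ 'n ^ 'n"
  shows "((*v) A ^^ k) (A *v v - c *s v) = ((*v) A ^^ Suc k) v - c *s ((*v) A ^^ k) v"
  by (induction k) (simp_all add: matrix_vector_mult_diff_distrib vector_scalar_commute)

text \<open>
  Induction on the degree of a polynomial \<open>q\<close> with \<open>q(A) v = 0\<close>. Split off
  a root \<open>c\<close>; the quotient annihilates \<open>w = (A - c) v\<close>, so the orbit of
  \<open>w\<close> is summable. If \<open>\<bar>c\<bar> < 1\<close>, the orbit of \<open>v\<close>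
  satisfies a contractive recurrence driven by that of \<open>w\<close>. Otherwise \<open>c\<close>
  is not an eigenvalue, so \<open>A - c\<close> is bounded below and the orbit of \<open>w\<close>
  dominates that of \<open>v\<close>.
\<close>

lemma summable_orbit_if_annihilated:
  fixes A :: "complex ^ 'n ^ 'n"
  assumes eig: "\<And>c u. u \<noteq> 0 \<Longrightarrow> A *v u = c *s u \<Longrightarrow> cmod c < 1"
    and "q \<noteq> 0" and "(\<Sum>i\<le>degree q. coeff q i *s ((*v) A ^^ i) v) = 0"
  shows "summable (\<lambda>k. norm (((*v) A ^^ k) v))"
  using assms(2-)
proof (induction "degree q" arbitrary: q v)
  case 0
  have "v = 0"
    using 0 by (auto simp: vector_mul_eq_0 leading_coeff_0_iff[of q, symmetric] simp del: leading_coeff_0_iff)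
  have "((*v) A ^^ k) v = 0" for k
    by (induction k) (simp_all add: \<open>v = 0\<close>)
  then show ?case by simp
next
  case (Suc m)
  have "\<not> constant (poly q)"
    using Suc.hyps(2) by (simp add: constant_degree)
  then obtain c where "poly q c = 0"
    using fundamental_theorem_of_algebra by blast
  then obtain r where q: "q = [:- c, 1:] * r"
    by (auto simp: poly_eq_0_iff_dvd)
  have "r \<noteq> 0" using q Suc.prems(1) by auto
  have "degree q = Suc (degree r)"
    unfolding q using \<open>r \<noteq> 0\<close> by (subst degree_mult_eq) auto
  then have m: "m = degree r" using Suc.hyps(2) by simp
  define X where "X k = ((*v) A ^^ k) v" for k
  define w where "w = A *v v - c *s v"
  have Xw: "((*v) A ^^ k) w = X (Suc k) - c *s X k" for k
    unfolding w_def X_def by (rule funpow_matrix_vector_diff)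
  have q0: "coeff q 0 = - c * coeff r 0" and qS: "coeff q (Suc i) = coeff r i - c * coeff r (Suc i)" for i
    by (simp_all add: q)
  have "(\<Sum>i\<le>degree r. coeff r i *s (X (Suc i) - c *s X i))
      = (\<Sum>i\<le>degree r. coeff r i *s X (Suc i)) - c *s (\<Sum>i\<le>degree r. coeff r i *s X i)"
    by (simp add: vec_eq_iff sum_subtractf algebra_simps sum_distrib_left)
  also have "(\<Sum>i\<le>degree r. coeff r i *s X i) = (\<Sum>i\<le>Suc (degree r). coeff r i *s X i)"
    by (simp add: coeff_eq_0)
  also have "\<dots> = coeff r 0 *s X 0 + (\<Sum>i\<le>degree r. coeff r (Suc i) *s X (Suc i))"
    by (rule sum.atMost_Suc_shift)
  also have "(\<Sum>i\<le>degree r. coeff r i *s X (Suc i)) - c *s \<dots>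
      = coeff q 0 *s X 0 + (\<Sum>i\<le>degree r. coeff q (Suc i) *s X (Suc i))"
    by (simp add: q0 qS vec_eq_iff sum_subtractf algebra_simps sum_distrib_left)
  also have "\<dots> = (\<Sum>i\<le>Suc (degree r). coeff q i *s X i)"
    by (rule sum.atMost_Suc_shift[symmetric])
  also have "\<dots> = 0"
    using Suc.prems(2) by (simp only: X_def \<open>degree q = Suc (degree r)\<close>)
  finally have "summable (\<lambda>k. norm (((*v) A ^^ k) w))"
    by (intro Suc.hyps(1)[OF m \<open>r \<noteq> 0\<close>]) (simp add: Xw)
  then have sw: "summable (\<lambda>k. norm (X (Suc k) - c *s X k))"
    by (simp add: Xw)
  show ?case
    unfolding X_def[symmetric]
  proof (cases "cmod c < 1")
    case True
    have "norm (X (Suc k)) \<le> cmod c * norm (X k) + norm (X (Suc k) - c *s X k)" for k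
      using norm_triangle_ineq[of "c *s X k" "X (Suc k) - c *s X k"]
      by (simp add: norm_vector_scalar_mult)
    then show "summable (\<lambda>k. norm (X k))"
      by (intro summable_of_contractive_recurrence[OF _ True _ _ _ sw]) auto
  next
    case False
    define g where "g u = A *v u - c *s u" for u
    have "linear g"
      by (rule linearI) (simp_all add: g_def vec_eq_iff matrix_vector_mult_def algebra_simps
            sum.distrib scaleR_sum_right)
    moreover have "inj g"
      unfolding linear_injective_0[OF \<open>linear g\<close>] using eig False by (auto simp: g_def)
    ultimately obtain b where b: "b > 0" "\<And>u. b * norm u \<le> norm (g u)"
      using linear_inj_bounded_below_pos by blast
    have "norm (X k) \<le> norm (X (Suc k) - c *s X k) / b" for k
      using b(2)[of "X k"] b(1) by (simp add: g_def X_def field_simps)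
    then show "summable (\<lambda>k. norm (X k))"
      by (intro summable_comparison_test'[OF summable_divide[OF sw, of b]]) auto
  qed
qed

text \<open>
  More than \<open>DIM\<close> many points of the orbit are linearly dependent, already over the
  reals.
\<close>

lemma ex_annihilating_poly:
  fixes A :: "complex ^ 'n ^ 'n"
  shows "\<exists>q. q \<noteq> 0 \<and> (\<Sum>i\<le>degree q. coeff q i *s ((*v) A ^^ i) v) = 0"
proof -
  define X where "X k = ((*v) A ^^ k) v" for k
  define N where "N = DIM(complex ^ 'n)"
  have "\<exists>a. (\<exists>i\<le>N. a i \<noteq> 0) \<and> (\<Sum>i\<le>N. a i *\<^sub>R X i) = 0"
  proof (cases "inj_on X {..N}")
    case True
    then have "card (X ` {..N}) > DIM(complex ^ 'n)"
      by (simp add: card_image N_def)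
    then have "dependent (X ` {..N})"
      by (intro dependent_biggerset)
    then obtain u where u: "\<exists>v\<in>X ` {..N}. u v \<noteq> 0" "(\<Sum>v\<in>X ` {..N}. u v *\<^sub>R v) = 0"
      by (auto simp: dependent_finite)
    then show ?thesis
      using True by (intro exI[of _ "u \<circ> X"]) (auto simp: sum.reindex)
  next
    case False
    then obtain i j where ij: "i \<le> N" "j \<le> N" "X i = X j" "i \<noteq> j"
      by (auto simp: inj_on_def)
    have "(\<Sum>k\<le>N. ((if k = i then 1 else 0) - (if k = j then 1 else 0)) *\<^sub>R X k) = 0"
      using ij by (simp add: scaleR_left_diff_distrib sum_subtractf if_distrib[of "\<lambda>c. c *\<^sub>R _"] cong: if_cong)
    with ij show ?thesis
      by (intro exI[of _ "\<lambda>k. (if k = i then 1 else 0) - (if k = j then 1 else 0)"]) auto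
  qed
  then obtain a where a: "\<exists>i\<le>N. a i \<noteq> 0" "(\<Sum>i\<le>N. a i *\<^sub>R X i) = 0"
    by blast
  define q where "q = (\<Sum>i\<le>N. monom (complex_of_real (a i)) i)"
  have cq: "coeff q i = (if i \<le> N then of_real (a i) else 0)" for i
    by (simp add: q_def coeff_sum)
  have "q \<noteq> 0"
    using a(1) cq by (metis coeff_0 of_real_eq_0_iff)
  have "degree q \<le> N"
    by (rule degree_le) (simp add: cq)
  then have "(\<Sum>i\<le>degree q. coeff q i *s X i) = (\<Sum>i\<le>N. coeff q i *s X i)"
    by (intro sum.mono_neutral_left) (auto simp: coeff_eq_0)
  also have "\<dots> = (\<Sum>i\<le>N. a i *\<^sub>R X i)"
    by (intro sum.cong refl) (simp add: cq vec_eq_iff, simp add: scaleR_conv_of_real)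
  finally show ?thesis using a(2) \<open>q \<noteq> 0\<close> by (auto simp: X_def)
qed

lemma complex_of_real_matrix_vector_mult:
  "map_matrix complex_of_real M *v (\<chi> i. of_real (x $ i)) = (\<chi> i. of_real ((M *v x) $ i))"
  by (simp add: vec_eq_iff matrix_vector_mult_def)

lemma expanding_imp_invertible:
  fixes M :: "real ^ 'n ^ 'n"
  assumes "expanding M"
  shows "invertible M"
proof -
  have "x = 0" if "M *v x = 0" for x
  proof (rule ccontr)
    assume "x \<noteq> 0"
    then have "eigenvalue_of M 0"
      unfolding eigenvalue_of_def using that
      by (intro exI[of _ "\<chi> i. of_real (x $ i)"]) (auto simp: complex_of_real_matrix_vector_mult vec_eq_iff)
    with assms show False by (auto simp: expanding_def)
  qed
  then show ?thesis
    using invertible_left_inverse matrix_left_invertible_ker by blast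
qed

lemma matrix_inv_both:
  fixes M :: "real ^ 'n ^ 'n"
  assumes "invertible M"
  shows "M ** matrix_inv M = mat 1" "matrix_inv M ** M = mat 1"
  using assms someI_ex[of "\<lambda>A'. M ** A' = mat 1 \<and> A' ** M = mat 1"]
  by (auto simp: matrix_inv_def invertible_def)

lemma matrix_inv_cancel:
  fixes M :: "real ^ 'n ^ 'n"
  assumes "invertible M"
  shows "M *v (matrix_inv M *v x) = x" "matrix_inv M *v (M *v x) = x"
  using assms by (simp_all add: matrix_vector_mul_assoc matrix_inv_both)

lemma map_matrix_of_real_mult:
  "map_matrix complex_of_real (A ** B) = map_matrix of_real A ** map_matrix of_real B"
  by (simp add: vec_eq_iff matrix_matrix_mult_def)

lemma expanding_imp_summable_inverse_orbit:
  fixes M :: "real ^ 'n ^ 'n"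
  assumes "expanding M"
  shows "summable (\<lambda>k. norm (((*v) (matrix_inv M) ^^ k) x))"
proof -
  let ?c = "map_matrix complex_of_real"
  define v :: "complex ^ 'n" where "v = (\<chi> i. of_real (x $ i))"
  have inv: "invertible M" by (rule expanding_imp_invertible[OF assms])
  have "?c M ** ?c (matrix_inv M) = mat 1"
    unfolding map_matrix_of_real_mult[symmetric] matrix_inv_both[OF inv]
    by (simp add: vec_eq_iff mat_def)
  then have inv_c: "?c M *v (?c (matrix_inv M) *v u) = u" for u
    by (simp add: matrix_vector_mul_assoc)
  have eig: "cmod c < 1" if "u \<noteq> 0" "?c (matrix_inv M) *v u = c *s u" for c u
  proof -
    have u: "u = c *s (?c M *v u)"
      using inv_c[of u] that by (simp add: vector_scalar_commute)
    then have "c \<noteq> 0" using \<open>u \<noteq> 0\<close> by auto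
    then have "?c M *v u = inverse c *s u"
      by (subst (2) u) (simp add: vec_eq_iff)
    then have "cmod (inverse c) > 1"
      using assms \<open>u \<noteq> 0\<close> unfolding expanding_def eigenvalue_of_def by blast
    then show ?thesis
      using \<open>c \<noteq> 0\<close> by (simp add: norm_inverse one_less_inverse_iff)
  qed
  obtain q where "q \<noteq> 0" "(\<Sum>i\<le>degree q. coeff q i *s ((*v) (?c (matrix_inv M)) ^^ i) v) = 0"
    using ex_annihilating_poly by blast
  then have "summable (\<lambda>k. norm (((*v) (?c (matrix_inv M)) ^^ k) v))"
    by (intro summable_orbit_if_annihilated eig)
  moreover have "((*v) (?c (matrix_inv M)) ^^ k) v = (\<chi> i. of_real ((((*v) (matrix_inv M) ^^ k) x) $ i))" for k
    by (induction k) (simp_all add: v_def complex_of_real_matrix_vector_mult)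
  moreover have "norm (\<chi> i. complex_of_real (y $ i)) = norm y" for y :: "real ^ 'n"
    by (simp add: norm_vec_def)
  ultimately show ?thesis by simp
qed

section \<open>Existence and uniqueness of self-affine measures\<close>

lemma ifs_map_measurable[measurable]: "ifs_map M d \<in> borel_measurable borel"
proof -
  have "continuous_on UNIV (ifs_map M d)"
    unfolding ifs_map_def
    by (intro bounded_linear.continuous_on[OF matrix_vector_mul_bounded_linear] continuous_intros)
  then show ?thesis by (rule borel_measurable_continuous_onI)
qed

lemma ifs_map_pair_measurable:
  fixes M :: "real ^ 'n ^ 'n"
  shows "(\<lambda>(d, x). ifs_map M d x) \<in> measure_pmf P \<Otimes>\<^sub>M borel \<rightarrow>\<^sub>M borel"
proof -
  have "(\<lambda>z. fst z) \<in> measure_pmf P \<Otimes>\<^sub>M (borel :: (real ^ 'n) measure) \<rightarrow>\<^sub>M borel"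
    by (rule measurable_compose[OF measurable_fst]) simp
  then have "(\<lambda>z. snd z + fst z) \<in> measure_pmf P \<Otimes>\<^sub>M (borel :: (real ^ 'n) measure) \<rightarrow>\<^sub>M borel"
    by (intro borel_measurable_add measurable_snd)
  from measurable_compose[OF this ifs_map_measurable[of M 0]] show ?thesis
    by (simp add: ifs_map_def split_beta)
qed

lemma is_self_affine_measureD:
  assumes "is_self_affine_measure M D \<mu>"
  shows "prob_space \<mu>" "sets \<mu> = sets borel"
    and "S \<in> sets borel \<Longrightarrow> measure \<mu> S = 1 / real (card D) * (\<Sum>d\<in>D. measure \<mu> (ifs_map M d -` S))"
  using assms unfolding is_self_affine_measure_def by blast+

text \<open>
  Digits and points are drawn jointly, so that self-affinity becomes invariance under a single
  push-forward and integrals can be computed by Fubini.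
\<close>

lemma self_affine_eq_pushforward:
  assumes "is_self_affine_measure M D \<mu>" and D: "finite D" "D \<noteq> {}"
  shows "\<mu> = distr (measure_pmf (pmf_of_set D) \<Otimes>\<^sub>M \<mu>) borel (\<lambda>(d, x). ifs_map M d x)"
    (is "_ = distr (?P \<Otimes>\<^sub>M _) _ ?\<phi>")
proof (rule measure_eqI)
  interpret prob_space \<mu> by (rule is_self_affine_measureD[OF assms(1)])
  have sets[measurable_cong]: "sets \<mu> = sets borel"
    by (rule is_self_affine_measureD[OF assms(1)])
  have space: "space \<mu> = UNIV" using sets_eq_imp_space_eq[OF sets] by simp
  show "sets \<mu> = sets (distr (?P \<Otimes>\<^sub>M \<mu>) borel ?\<phi>)" by (simp add: sets)
  fix S assume S: "S \<in> sets \<mu>"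
  then have Sb: "S \<in> sets borel" by (simp add: sets)
  have m: "?\<phi> \<in> ?P \<Otimes>\<^sub>M \<mu> \<rightarrow>\<^sub>M borel"
    by (subst measurable_cong_sets[OF sets_pair_measure_cong[OF refl sets] refl]) (rule ifs_map_pair_measurable)
  have "emeasure (distr (?P \<Otimes>\<^sub>M \<mu>) borel ?\<phi>) S
      = emeasure (?P \<Otimes>\<^sub>M \<mu>) (?\<phi> -` S \<inter> space (?P \<Otimes>\<^sub>M \<mu>))"
    by (rule emeasure_distr[OF m Sb])
  also have "\<dots> = (\<integral>\<^sup>+d. emeasure \<mu> (Pair d -` (?\<phi> -` S \<inter> space (?P \<Otimes>\<^sub>M \<mu>))) \<partial>?P)"
    by (rule emeasure_pair_measure_alt[OF measurable_sets[OF m Sb]])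
  also have "\<dots> = (\<integral>\<^sup>+d. ennreal (measure \<mu> (ifs_map M d -` S)) \<partial>?P)"
    by (intro nn_integral_cong)
      (auto simp: emeasure_eq_measure space_pair_measure space intro!: arg_cong[where f="measure \<mu>"])
  also have "\<dots> = (\<Sum>d\<in>D. ennreal (measure \<mu> (ifs_map M d -` S))) / card D"
    by (rule nn_integral_pmf_of_set[OF D(2,1)])
  also have "\<dots> = ennreal ((\<Sum>d\<in>D. measure \<mu> (ifs_map M d -` S)) / real (card D))"
    using D by (simp add: sum_ennreal sum_nonneg divide_ennreal ennreal_of_nat_eq_real_of_nat card_gt_0_iff)
  also have "\<dots> = emeasure \<mu> S"
    unfolding emeasure_eq_measure is_self_affine_measureD(3)[OF assms(1) Sb] by simp
  finally show "emeasure \<mu> S = emeasure (distr (?P \<Otimes>\<^sub>M \<mu>) borel ?\<phi>) S" by simp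
qed

lemma self_affine_integral:
  fixes f :: "real ^ 'n \<Rightarrow> 'b :: {banach, second_countable_topology}"
  assumes sa: "is_self_affine_measure M D \<mu>" and D: "finite D" "D \<noteq> {}"
    and f[measurable]: "f \<in> borel_measurable borel" and bounded: "\<And>x. norm (f x) \<le> K"
  shows "(LINT x|\<mu>. f x) = (\<Sum>d\<in>D. LINT x|\<mu>. f (ifs_map M d x)) /\<^sub>R card D"
proof -
  let ?P = "measure_pmf (pmf_of_set D)"
  interpret \<mu>: prob_space \<mu> by (rule is_self_affine_measureD[OF sa])
  interpret pair_prob_space ?P \<mu> ..
  have sets[measurable_cong]: "sets \<mu> = sets borel"
    by (rule is_self_affine_measureD[OF sa])
  have m[measurable]: "(\<lambda>(d, x). ifs_map M d x) \<in> ?P \<Otimes>\<^sub>M \<mu> \<rightarrow>\<^sub>M borel"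
    by (subst measurable_cong_sets[OF sets_pair_measure_cong[OF refl sets] refl]) (rule ifs_map_pair_measurable)
  have "(LINT x|\<mu>. f x) = (LINT z|(?P \<Otimes>\<^sub>M \<mu>). f (case z of (d, x) \<Rightarrow> ifs_map M d x))"
    by (subst self_affine_eq_pushforward[OF sa D], subst integral_distr) auto
  also have "\<dots> = (LINT z|(?P \<Otimes>\<^sub>M \<mu>). (case z of (d, x) \<Rightarrow> f (ifs_map M d x)))"
    by (intro Bochner_Integration.integral_cong) auto
  also have "\<dots> = (LINT d|?P. LINT x|\<mu>. f (ifs_map M d x))"
  proof (rule integral_fst'[symmetric, of "\<lambda>(d, x). f (ifs_map M d x)", simplified])
    show "integrable (?P \<Otimes>\<^sub>M \<mu>) (\<lambda>(d, x). f (ifs_map M d x))"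
      using measurable_compose[OF m f]
      by (intro P.integrable_const_bound[where B=K]) (auto simp: bounded split_beta)
  qed
  also have "\<dots> = (\<Sum>d\<in>D. LINT x|\<mu>. f (ifs_map M d x)) /\<^sub>R card D"
    by (subst integral_measure_pmf[of D]) (auto simp: D scaleR_sum_right set_pmf_of_set inverse_eq_divide)
  finally show ?thesis .
qed

text \<open>
  The dual (transfer) operator on test functions: integration against a self-affine measure is
  invariant under it.
\<close>

definition digit_average ::
  "real ^ 'n ^ 'n \<Rightarrow> (real ^ 'n) set \<Rightarrow> (real ^ 'n \<Rightarrow> real) \<Rightarrow> real ^ 'n \<Rightarrow> real" where
  "digit_average M D f x = (\<Sum>d\<in>D. f (ifs_map M d x)) / card D"

lemma digit_average_measurable:
  "f \<in> borel_measurable borel \<Longrightarrow> digit_average M D f \<in> borel_measurable borel"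
  unfolding digit_average_def
  by (intro borel_measurable_divide borel_measurable_sum borel_measurable_const)
    (rule measurable_compose[OF ifs_map_measurable])

lemma abs_average_le:
  fixes g :: "'a \<Rightarrow> real"
  assumes "finite D" "D \<noteq> {}" "\<And>d. d \<in> D \<Longrightarrow> \<bar>g d\<bar> \<le> K"
  shows "\<bar>(\<Sum>d\<in>D. g d) / card D\<bar> \<le> K"
proof -
  have "\<bar>\<Sum>d\<in>D. g d\<bar> \<le> (\<Sum>d\<in>D. K)"
    using assms by (intro order_trans[OF sum_abs] sum_mono) auto
  then show ?thesis
    using assms by (simp add: divide_le_eq card_gt_0_iff mult.commute)
qed

lemma digit_average_iterate:
  assumes sa: "is_self_affine_measure M D \<mu>" and D: "finite D" "D \<noteq> {}"
    and f: "f \<in> borel_measurable borel" and bounded: "\<And>x. \<bar>f x\<bar> \<le> K"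
  shows "(digit_average M D ^^ k) f \<in> borel_measurable borel \<and> (\<forall>x. \<bar>(digit_average M D ^^ k) f x\<bar> \<le> K)
    \<and> (LINT x|\<mu>. (digit_average M D ^^ k) f x) = (LINT x|\<mu>. f x)"
proof (induction k)
  case (Suc k)
  interpret \<mu>: prob_space \<mu> by (rule is_self_affine_measureD[OF sa])
  have sets[measurable_cong]: "sets \<mu> = sets borel"
    by (rule is_self_affine_measureD[OF sa])
  define g where "g = (digit_average M D ^^ k) f"
  have g[measurable]: "g \<in> borel_measurable borel" and K: "\<And>x. \<bar>g x\<bar> \<le> K"
    using Suc by (auto simp: g_def)
  have "(LINT x|\<mu>. g x) = (\<Sum>d\<in>D. LINT x|\<mu>. g (ifs_map M d x)) /\<^sub>R card D"
    by (rule self_affine_integral[OF sa D g, of K]) (simp add: K)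
  also have "\<dots> = (LINT x|\<mu>. digit_average M D g x)"
    unfolding digit_average_def
    by (subst Bochner_Integration.integral_divide_zero, subst Bochner_Integration.integral_sum)
      (auto intro!: \<mu>.integrable_const_bound[where B=K] simp: K divide_inverse)
  finally have "(LINT x|\<mu>. digit_average M D g x) = (LINT x|\<mu>. f x)"
    using Suc by (simp add: g_def)
  moreover have "\<bar>digit_average M D g x\<bar> \<le> K" for x
    unfolding digit_average_def using K by (intro abs_average_le D)
  ultimately show ?case
    using digit_average_measurable[OF g, of M D] by (simp add: g_def)
next
  case 0
  show ?case unfolding funpow_0 by (intro conjI allI f bounded refl)
qed

text \<open>
  All branches of the iterated function system have the linear part
  \<open>M\<^sup>-\<^sup>1\<close>: composing with any of them replaces \<open>x - y\<close> by
  \<open>M\<^sup>-\<^sup>1 (x - y)\<close>, and averaging keeps a bound that holds for each branch.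
\<close>

lemma digit_average_iterate_lipschitz:
  assumes D: "finite D" "D \<noteq> {}" and lip: "\<And>x y. \<bar>f x - f y\<bar> \<le> L * norm (x - y)"
  shows "\<bar>(digit_average M D ^^ k) f x - (digit_average M D ^^ k) f y\<bar>
    \<le> L * norm (((*v) (matrix_inv M) ^^ k) (x - y))"
proof (induction k arbitrary: x y)
  case (Suc k)
  define g where "g = (digit_average M D ^^ k) f"
  have "\<bar>g (ifs_map M d x) - g (ifs_map M d y)\<bar> \<le> L * norm (((*v) (matrix_inv M) ^^ Suc k) (x - y))" for d
  proof -
    have "((*v) (matrix_inv M) ^^ Suc k) (x - y)
        = ((*v) (matrix_inv M) ^^ k) (ifs_map M d x - ifs_map M d y)"
      unfolding funpow_Suc_right o_def ifs_map_def matrix_vector_mult_diff_distrib[symmetric] by simp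
    then show ?thesis
      using Suc[of "ifs_map M d x" "ifs_map M d y"] by (simp only: g_def)
  qed
  then have "\<bar>(\<Sum>d\<in>D. g (ifs_map M d x) - g (ifs_map M d y)) / card D\<bar>
      \<le> L * norm (((*v) (matrix_inv M) ^^ Suc k) (x - y))"
    by (rule abs_average_le[OF D])
  moreover have "(digit_average M D ^^ Suc k) f z = (\<Sum>d\<in>D. g (ifs_map M d z)) / card D" for z
    unfolding g_def funpow.simps o_def by (rule digit_average_def)
  ultimately show ?case
    by (simp only: sum_subtractf diff_divide_distrib)
next
  case 0
  show ?case unfolding funpow_0 by (rule lip)
qed

text \<open>
  The iterated averages flatten to a constant without changing the integral. The limit on the left
  does not mention \<open>\<mu>\<close>, which is what gives uniqueness.
\<close>

lemma self_affine_lipschitz_integral_limit: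
  assumes sa: "is_self_affine_measure M D \<mu>" and D: "finite D" "D \<noteq> {}" and exp: "expanding M"
    and f: "f \<in> borel_measurable borel" and bounded: "\<And>x. \<bar>f x\<bar> \<le> K"
    and lip: "\<And>x y. \<bar>f x - f y\<bar> \<le> L * norm (x - y)"
  shows "(\<lambda>k. (digit_average M D ^^ k) f 0) \<longlonglongrightarrow> (LINT x|\<mu>. f x)"
proof -
  interpret \<mu>: prob_space \<mu> by (rule is_self_affine_measureD[OF sa])
  have sets[measurable_cong]: "sets \<mu> = sets borel"
    by (rule is_self_affine_measureD[OF sa])
  let ?T = "\<lambda>k. (digit_average M D ^^ k) f"
  note T = digit_average_iterate[OF sa D f bounded]
  have [measurable]: "?T k \<in> borel_measurable borel" for k using T by blast
  have "(\<lambda>k. LINT x|\<mu>. ?T k 0 - ?T k x) \<longlonglongrightarrow> (LINT x|\<mu>. 0)"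
  proof (rule integral_dominated_convergence[where w="\<lambda>_. 2 * K"])
    have "(\<lambda>k. ?T k 0 - ?T k x) \<longlonglongrightarrow> 0" for x
    proof (rule Lim_null_comparison)
      show "\<forall>\<^sub>F k in sequentially. norm (?T k 0 - ?T k x) \<le> L * norm (((*v) (matrix_inv M) ^^ k) (0 - x))"
        unfolding real_norm_def
        by (intro always_eventually allI digit_average_iterate_lipschitz[OF D lip])
      show "(\<lambda>k. L * norm (((*v) (matrix_inv M) ^^ k) (0 - x))) \<longlonglongrightarrow> 0"
        using tendsto_mult_left[OF summable_LIMSEQ_zero[OF expanding_imp_summable_inverse_orbit[OF exp, of "0 - x"]], of L]
        by simp
    qed
    then show "AE x in \<mu>. (\<lambda>k. ?T k 0 - ?T k x) \<longlonglongrightarrow> 0" by simp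
    show "AE x in \<mu>. norm (?T k 0 - ?T k x) \<le> 2 * K" for k
    proof (intro AE_I2)
      fix x
      have "\<bar>?T k 0\<bar> \<le> K" "\<bar>?T k x\<bar> \<le> K" using T[of k] by blast+
      then show "norm (?T k 0 - ?T k x) \<le> 2 * K" unfolding real_norm_def by linarith
    qed
  qed simp_all
  moreover have "(LINT x|\<mu>. ?T k 0 - ?T k x) = ?T k 0 - (LINT x|\<mu>. f x)" for k
  proof -
    have "\<bar>?T k x\<bar> \<le> K" for x using T[of k] by blast
    then have "integrable \<mu> (?T k)"
      by (intro \<mu>.integrable_const_bound[where B=K] AE_I2) simp_all
    then have "(LINT x|\<mu>. ?T k 0 - ?T k x) = ?T k 0 - (LINT x|\<mu>. ?T k x)"
      by (subst Bochner_Integration.integral_diff) (simp_all add: \<mu>.prob_space)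
    also have "(LINT x|\<mu>. ?T k x) = (LINT x|\<mu>. f x)" using T[of k] by blast
    finally show ?thesis .
  qed
  ultimately have "(\<lambda>k. ?T k 0 - (LINT x|\<mu>. f x)) \<longlonglongrightarrow> 0" by simp
  from tendsto_add[OF this tendsto_const[of "LINT x|\<mu>. f x"]] show ?thesis by simp
qed

text \<open>
  Closed sets generate the Borel sets, and the indicator of a closed set \<open>C\<close> is the
  decreasing limit of the Lipschitz functions \<open>max 0 (1 - n * infdist x C)\<close>.
\<close>

lemma borel_prob_eqI_lipschitz:
  fixes \<mu> \<nu> :: "(real ^ 'n) measure"
  assumes "prob_space \<mu>" "prob_space \<nu>" and sets: "sets \<mu> = sets borel" "sets \<nu> = sets borel"
    and eq: "\<And>(f :: real ^ 'n \<Rightarrow> real) L. f \<in> borel_measurable borel \<Longrightarrow> (\<And>x. \<bar>f x\<bar> \<le> 1)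
      \<Longrightarrow> (\<And>x y. \<bar>f x - f y\<bar> \<le> L * norm (x - y)) \<Longrightarrow> (LINT x|\<mu>. f x) = (LINT x|\<nu>. f x)"
  shows "\<mu> = \<nu>"
proof -
  have lim: "(\<lambda>n. LINT x|\<kappa>. max 0 (1 - real n * infdist x C)) \<longlonglongrightarrow> measure \<kappa> C"
    if "prob_space \<kappa>" and s[measurable_cong]: "sets \<kappa> = sets borel" and "closed C" "C \<noteq> {}"
    for \<kappa> :: "(real ^ 'n) measure" and C
  proof -
    interpret prob_space \<kappa> by fact
    have [measurable]: "C \<in> sets borel" using \<open>closed C\<close> by simp
    have "(\<lambda>n. LINT x|\<kappa>. max 0 (1 - real n * infdist x C)) \<longlonglongrightarrow> (LINT x|\<kappa>. indicator C x)"
    proof (rule integral_dominated_convergence[where w="\<lambda>_. 1"])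
      have "(\<lambda>n. max 0 (1 - real n * infdist x C)) \<longlonglongrightarrow> indicator C x" for x
      proof (cases "x \<in> C")
        case False
        then have pos: "infdist x C > 0"
          using \<open>closed C\<close> \<open>C \<noteq> {}\<close> in_closed_iff_infdist_zero[of C x] infdist_nonneg[of x C] by auto
        then obtain N where N: "1 < real N * infdist x C"
          using reals_Archimedean3 by blast
        have "max 0 (1 - real n * infdist x C) = 0" if "n \<ge> N" for n
        proof -
          have "real N * infdist x C \<le> real n * infdist x C"
            using that pos by (intro mult_right_mono) auto
          then show ?thesis using N by (simp add: max_def)
        qed
        then show ?thesis using False
          by (intro tendsto_eventually) (auto simp: eventually_sequentially)
      qed (simp add: infdist_zero)
      then show "AE x in \<kappa>. (\<lambda>n. max 0 (1 - real n * infdist x C)) \<longlonglongrightarrow> indicator C x" by simp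
      show "(\<lambda>x. max 0 (1 - real n * infdist x C)) \<in> borel_measurable \<kappa>" for n
        unfolding measurable_cong_sets[OF s refl]
        by (intro borel_measurable_continuous_onI continuous_intros continuous_on_infdist)
      show "AE x in \<kappa>. norm (max 0 (1 - real n * infdist x C)) \<le> 1" for n
        by (intro AE_I2) (simp add: infdist_nonneg)
    qed simp_all
    then show ?thesis by (simp add: sets_eq_imp_space_eq[OF s])
  qed
  interpret \<mu>: prob_space \<mu> by fact
  interpret \<nu>: prob_space \<nu> by fact
  have closed: "emeasure \<mu> C = emeasure \<nu> C" if "closed C" for C
  proof (cases "C = {}")
    case False
    have "(LINT x|\<mu>. max 0 (1 - real n * infdist x C)) = (LINT x|\<nu>. max 0 (1 - real n * infdist x C))" for n
    proof (rule eq[where L="real n"])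
      fix x y
      have "\<bar>max 0 (1 - real n * infdist x C) - max 0 (1 - real n * infdist y C)\<bar>
          \<le> \<bar>real n * infdist x C - real n * infdist y C\<bar>" by linarith
      also have "\<dots> = real n * \<bar>infdist x C - infdist y C\<bar>"
        by (simp add: abs_mult flip: right_diff_distrib)
      also have "\<dots> \<le> real n * norm (x - y)"
        using infdist_triangle_abs[of x C y] by (intro mult_left_mono) (auto simp: dist_norm)
      finally show "\<bar>max 0 (1 - real n * infdist x C) - max 0 (1 - real n * infdist y C)\<bar> \<le> real n * norm (x - y)" .
      show "(\<lambda>x. max 0 (1 - real n * infdist x C)) \<in> borel_measurable borel"
        by (intro borel_measurable_continuous_onI continuous_intros continuous_on_infdist)
    qed (simp add: infdist_nonneg)
    then have "measure \<mu> C = measure \<nu> C"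
      using lim[OF \<open>prob_space \<mu>\<close> sets(1) that False] lim[OF \<open>prob_space \<nu>\<close> sets(2) that False]
      by (simp add: LIMSEQ_unique)
    then show ?thesis by (simp add: \<mu>.emeasure_eq_measure \<nu>.emeasure_eq_measure)
  qed simp
  show ?thesis
  proof (rule measure_eqI_generator_eq[of "Collect closed" UNIV _ _ "\<lambda>_. UNIV"])
    have "sets (borel :: (real ^ 'n) measure) = sigma_sets UNIV (Collect closed)"
      unfolding borel_eq_closed by (rule sets_measure_of) simp
    then show "sets \<mu> = sigma_sets UNIV (Collect closed)" "sets \<nu> = sigma_sets UNIV (Collect closed)"
      by (simp_all only: sets)
    show "emeasure \<mu> C = emeasure \<nu> C" if "C \<in> Collect closed" for C
      using closed that by blast
  qed (simp_all add: Int_stable_def closed_Int \<mu>.emeasure_eq_measure)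
qed

lemma self_affine_measure_unique:
  fixes M :: "real ^ 'n ^ 'n"
  assumes D: "finite D" "D \<noteq> {}" and exp: "expanding M"
    and \<mu>: "is_self_affine_measure M D \<mu>" and \<nu>: "is_self_affine_measure M D \<nu>"
  shows "\<mu> = \<nu>"
proof (rule borel_prob_eqI_lipschitz)
  fix f :: "real ^ 'n \<Rightarrow> real" and L
  assume f: "f \<in> borel_measurable borel" "\<And>x. \<bar>f x\<bar> \<le> 1" "\<And>x y. \<bar>f x - f y\<bar> \<le> L * norm (x - y)"
  show "(LINT x|\<mu>. f x) = (LINT x|\<nu>. f x)"
    using self_affine_lipschitz_integral_limit[OF \<mu> D exp f] self_affine_lipschitz_integral_limit[OF \<nu> D exp f]
    by (rule LIMSEQ_unique)
qed (fact is_self_affine_measureD(1,2)[OF \<mu>] is_self_affine_measureD(1,2)[OF \<nu>])+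

text \<open>
  The law of \<open>\<Sum>k. M\<^sup>-\<^sup>k\<^sup>-\<^sup>1 d\<^sub>k\<close> for an independent
  uniform sequence of digits: prepending a digit \<open>d\<close> to the sequence applies
  \<open>ifs_map M d\<close> to the sum.
\<close>

lemma self_affine_measure_exists:
  fixes M :: "real ^ 'n ^ 'n"
  assumes D: "finite D" "D \<noteq> {}" and exp: "expanding M"
  shows "\<exists>\<mu>. is_self_affine_measure M D \<mu>"
proof -
  define A where "A k = ((*v) (matrix_inv M) ^^ k)" for k
  have AS: "A (Suc k) x = matrix_inv M *v A k x" for k x by (simp add: A_def)
  (* The default 0 makes the series converge for every sequence, not just almost surely. *)
  define g where "g d = (if d \<in> D then d else 0)" for d
  define X where "X \<omega> = (\<Sum>k. A (Suc k) (g (\<omega> !! k)))" for \<omega>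
  let ?P = "measure_pmf (pmf_of_set D)"
  let ?S = "stream_space ?P"
  interpret S: prob_space ?S
    by (rule prob_space.prob_space_stream_space[OF prob_space_measure_pmf])
  have A0: "A k 0 = 0" for k by (induction k) (simp_all add: A_def)
  have sum: "summable (\<lambda>k. A (Suc k) (g (\<omega> !! k)))" for \<omega>
  proof (rule summable_norm_cancel, rule summable_comparison_test')
    have "summable (\<lambda>k. norm (A (Suc k) d))" for d
      using expanding_imp_summable_inverse_orbit[OF exp, of d]
      by (subst summable_Suc_iff) (simp add: A_def)
    then show "summable (\<lambda>k. \<Sum>d\<in>D. norm (A (Suc k) d))"
      by (intro summable_sum)
    show "norm (norm (A (Suc k) (g (\<omega> !! k)))) \<le> (\<Sum>d\<in>D. norm (A (Suc k) d))" for k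
      using member_le_sum[of "g (\<omega> !! k)" D "\<lambda>d. norm (A (Suc k) d)"] D
      by (cases "\<omega> !! k \<in> D") (auto simp: g_def A0 sum_nonneg)
  qed
  have X_Cons: "X (d ## \<omega>) = ifs_map M d (X \<omega>)" if "d \<in> D" for d \<omega>
  proof -
    have "X (d ## \<omega>) = A (Suc 0) d + (\<Sum>k. A (Suc (Suc k)) (g (\<omega> !! k)))"
      using suminf_split_head[OF sum, of "d ## \<omega>"] by (simp add: X_def g_def that)
    also have "(\<Sum>k. A (Suc (Suc k)) (g (\<omega> !! k))) = matrix_inv M *v X \<omega>"
      unfolding X_def AS[of "Suc _"]
      by (rule bounded_linear.suminf[OF matrix_vector_mul_bounded_linear sum, symmetric])
    finally show ?thesis
      unfolding ifs_map_def AS matrix_vector_right_distrib by (simp add: A_def add.commute)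
  qed
  have X[measurable]: "X \<in> borel_measurable ?S"
    unfolding X_def
  proof (rule borel_measurable_suminf)
    fix k
    show "(\<lambda>\<omega>. A (Suc k) (g (\<omega> !! k))) \<in> borel_measurable ?S"
      by (rule measurable_compose[OF measurable_snth]) simp
  qed
  define \<mu> where "\<mu> = distr ?S borel X"
  have space: "space ?S = UNIV" by (simp add: space_stream_space)
  interpret \<mu>: prob_space \<mu> unfolding \<mu>_def by (rule S.prob_space_distr[OF X])
  have "measure \<mu> T = 1 / real (card D) * (\<Sum>d\<in>D. measure \<mu> (ifs_map M d -` T))" if T: "T \<in> sets borel" for T
  proof -
    have vim: "ifs_map M d -` T \<in> sets borel" for d
      using measurable_sets[OF ifs_map_measurable T] by simp
    have "emeasure \<mu> T = emeasure ?S (X -` T)"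
      unfolding \<mu>_def using emeasure_distr[OF X T] by (simp add: space)
    also have "\<dots> = (\<integral>\<^sup>+d. emeasure ?S {\<omega>. d ## \<omega> \<in> X -` T} \<partial>?P)"
      using prob_space.emeasure_stream_space[OF prob_space_measure_pmf, of "X -` T" "pmf_of_set D"] measurable_sets[OF X T] by (simp add: space)
    also have "\<dots> = (\<Sum>d\<in>D. emeasure ?S {\<omega>. d ## \<omega> \<in> X -` T}) / card D"
      by (rule nn_integral_pmf_of_set[OF D(2,1)])
    also have "(\<Sum>d\<in>D. emeasure ?S {\<omega>. d ## \<omega> \<in> X -` T}) = (\<Sum>d\<in>D. emeasure \<mu> (ifs_map M d -` T))"
    proof (rule sum.cong[OF refl])
      fix d assume "d \<in> D"
      then have "{\<omega>. d ## \<omega> \<in> X -` T} = X -` (ifs_map M d -` T)" by (auto simp: X_Cons)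
      then show "emeasure ?S {\<omega>. d ## \<omega> \<in> X -` T} = emeasure \<mu> (ifs_map M d -` T)"
        unfolding \<mu>_def using emeasure_distr[OF X vim] by (simp add: space)
    qed
    also have "\<dots> / card D = ennreal ((\<Sum>d\<in>D. measure \<mu> (ifs_map M d -` T)) / real (card D))"
      using D by (simp add: \<mu>.emeasure_eq_measure sum_ennreal sum_nonneg divide_ennreal
          ennreal_of_nat_eq_real_of_nat card_gt_0_iff)
    finally have "measure \<mu> T = (\<Sum>d\<in>D. measure \<mu> (ifs_map M d -` T)) / real (card D)"
      unfolding \<mu>.emeasure_eq_measure
      by (subst (asm) ennreal_inj) (auto intro!: divide_nonneg_nonneg sum_nonneg)
    then show ?thesis by (simp only: times_divide_eq_left mult_1)
  qed
  moreover have "sets \<mu> = sets borel" by (simp add: \<mu>_def)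
  ultimately show ?thesis
    using \<mu>.prob_space_axioms unfolding is_self_affine_measure_def by blast
qed

lemma self_affine_measure_is_self_affine:
  assumes "finite D" "D \<noteq> {}" "expanding M"
  shows "is_self_affine_measure M D (self_affine_measure M D)"
  unfolding self_affine_measure_def
proof (rule theI')
  show "\<exists>!\<mu>. is_self_affine_measure M D \<mu>"
    using self_affine_measure_exists[OF assms] self_affine_measure_unique[OF assms] by blast
qed

section \<open>Zeros of the Fourier transform\<close>

lemma expo_diff: "expo l x * cnj (expo l' x) = expo (l - l') x"
  by (simp add: expo_def exp_cnj inner_diff_left algebra_simps flip: exp_add)

lemma expo_add_right: "expo l (x + y) = expo l x * expo l y"
  by (simp add: expo_def inner_add_right algebra_simps flip: exp_add)

lemma expo_commute: "expo l x = expo x l"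
  by (simp add: expo_def inner_commute)

lemma norm_expo: "norm (expo l x) = 1"
  by (simp add: expo_def)

lemma expo_zero_right: "expo l 0 = 1"
  by (simp add: expo_def)

lemma expo_matrix_vector: "expo l (A *v x) = expo (transpose A *v l) x"
  by (simp add: expo_def transpose_matrix_vector dot_lmul_matrix)

lemma continuous_on_expo: "continuous_on S (expo l)"
  unfolding expo_def by (intro continuous_intros)

lemma expo_measurable: "expo l \<in> borel_measurable borel"
  by (rule borel_measurable_continuous_onI[OF continuous_on_expo])

text \<open>
  At the point \<open>x\<close> on the line through \<open>d = l - l'\<close> with inner product
  \<open>1/2\<close>, the quotient of the two exponentials is \<open>-1\<close>.
\<close>

lemma expo_eq_iff: "expo l = expo l' \<longleftrightarrow> l = l'"
proof
  assume eq: "expo l = expo l'"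
  show "l = l'"
  proof (rule ccontr)
    assume "l \<noteq> l'"
    define d where "d = l - l'"
    have d: "d \<bullet> d \<noteq> 0" using \<open>l \<noteq> l'\<close> by (simp add: d_def)
    define x where "x = (1 / (2 * (d \<bullet> d))) *\<^sub>R d"
    have "d \<bullet> x = 1 / 2" using d by (simp add: x_def)
    then have "expo d x = exp (2 * pi * \<i> * complex_of_real (1 / 2))" by (simp only: expo_def)
    also have "\<dots> = exp (\<i> * pi)" by (simp add: mult.commute)
    also have "\<dots> = -1" by simp
    finally have "expo d x = -1" .
    moreover have "expo d x = 1"
      using norm_expo[of l' x] by (simp add: d_def eq complex_norm_square[symmetric] flip: expo_diff)
    ultimately show False by simp
  qed
qed simp

lemma mask_zero: "finite D \<Longrightarrow> D \<noteq> {} \<Longrightarrow> mask D 0 = 1"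
  by (simp add: mask_def expo_zero_right)

definition fourier :: "(real ^ 'n) measure \<Rightarrow> real ^ 'n \<Rightarrow> complex" where
  "fourier \<mu> l = (LINT x|\<mu>. expo l x)"

lemma orthogonal_set_E_iff:
  "orthogonal_set \<mu> (E \<Lambda>) \<longleftrightarrow> (\<forall>l\<in>\<Lambda>. \<forall>l'\<in>\<Lambda>. l \<noteq> l' \<longrightarrow> fourier \<mu> (l - l') = 0)"
  by (auto simp: orthogonal_set_def E_def expo_diff expo_eq_iff fourier_def)

lemma fourier_self_affine:
  assumes sa: "is_self_affine_measure M D \<mu>" and D: "finite D" "D \<noteq> {}"
  shows "fourier \<mu> l = mask D (transpose (matrix_inv M) *v l) * fourier \<mu> (transpose (matrix_inv M) *v l)"
proof -
  let ?l = "transpose (matrix_inv M) *v l"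
  have "fourier \<mu> l = (\<Sum>d\<in>D. LINT x|\<mu>. expo l (ifs_map M d x)) /\<^sub>R card D"
    unfolding fourier_def
    by (rule self_affine_integral[OF sa D expo_measurable, of _ 1]) (simp add: norm_expo)
  also have "\<dots> = (\<Sum>d\<in>D. LINT x|\<mu>. expo d ?l * expo ?l x) /\<^sub>R card D"
  proof -
    have "(LINT x|\<mu>. expo l (ifs_map M d x)) = (LINT x|\<mu>. expo d ?l * expo ?l x)" for d
      unfolding ifs_map_def expo_matrix_vector[of l] expo_add_right expo_commute[of d]
      by (simp only: mult.commute)
    then show ?thesis by (simp only:)
  qed
  also have "\<dots> = mask D ?l * fourier \<mu> ?l"
    by (simp add: mask_def fourier_def scaleR_conv_of_real sum_distrib_right inverse_eq_divide sum_divide_distrib)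
  finally show ?thesis .
qed

text \<open>
  Iterating the functional equation leaves a finite product of mask values times the transform at
  \<open>M\<^sup>-\<^sup>T\<^sup>k l\<close>. The latter tends to 1 by dominated convergence, after
  moving the matrix power from the frequency to the integration variable. So for large
  \<open>k\<close> only the mask factors can vanish.
\<close>

lemma fourier_zero_iff:
  assumes sa: "is_self_affine_measure M D \<mu>" and D: "finite D" "D \<noteq> {}" and exp: "expanding M"
  shows "fourier \<mu> l = 0 \<longleftrightarrow> (\<exists>j y. l = ((*v) (transpose M) ^^ Suc j) y \<and> mask D y = 0)"
proof -
  interpret \<mu>: prob_space \<mu> by (rule is_self_affine_measureD[OF sa])
  have sets: "sets \<mu> = sets borel"
    by (rule is_self_affine_measureD[OF sa])
  define L where "L k = ((*v) (transpose (matrix_inv M)) ^^ k)" for k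
  have L: "L (Suc k) l = transpose (matrix_inv M) *v L k l" for k l
    by (simp add: L_def)
  have prod: "fourier \<mu> l = (\<Prod>j<k. mask D (L (Suc j) l)) * fourier \<mu> (L k l)" for k
  proof (induction k)
    case (Suc k)
    then show ?case using fourier_self_affine[OF sa D, of "L k l"] by (simp add: L)
  qed (simp add: L_def)
  have shift: "expo (L k l) x = expo l (((*v) (matrix_inv M) ^^ k) x)" for k x
  proof (induction k arbitrary: x)
    case (Suc k)
    have "expo (L (Suc k) l) x = expo (L k l) (matrix_inv M *v x)"
      unfolding L expo_matrix_vector ..
    also have "\<dots> = expo l (((*v) (matrix_inv M) ^^ k) (matrix_inv M *v x))"
      by (rule Suc)
    finally show ?case by (simp only: funpow_Suc_right o_apply)
  qed (simp add: L_def)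
  have "(\<lambda>k. fourier \<mu> (L k l)) \<longlonglongrightarrow> (LINT x|\<mu>. 1)"
    unfolding fourier_def
  proof (rule integral_dominated_convergence[where w="\<lambda>_. 1"])
    show "AE x in \<mu>. (\<lambda>k. expo (L k l) x) \<longlonglongrightarrow> 1"
    proof (intro AE_I2)
      fix x
      have "(\<lambda>k. ((*v) (matrix_inv M) ^^ k) x) \<longlonglongrightarrow> 0"
        using summable_LIMSEQ_zero[OF expanding_imp_summable_inverse_orbit[OF exp, of x]]
        by (rule tendsto_norm_zero_cancel)
      then show "(\<lambda>k. expo (L k l) x) \<longlonglongrightarrow> 1"
        unfolding shift
        using continuous_on_tendsto_compose[OF continuous_on_expo[of UNIV l], of _ 0]
        by (simp add: expo_zero_right)
    qed
    show "expo (L k l) \<in> borel_measurable \<mu>" for k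
      unfolding measurable_cong_sets[OF sets refl] by (rule expo_measurable)
  qed (simp_all add: norm_expo)
  then have lim: "(\<lambda>k. fourier \<mu> (L k l)) \<longlonglongrightarrow> 1" by (simp add: \<mu>.prob_space)
  have zero: "fourier \<mu> l = 0 \<longleftrightarrow> (\<exists>j. mask D (L (Suc j) l) = 0)"
  proof
    assume zero: "fourier \<mu> l = 0"
    have "\<exists>k. fourier \<mu> (L k l) \<noteq> 0"
    proof (rule ccontr)
      assume "\<not> (\<exists>k. fourier \<mu> (L k l) \<noteq> 0)"
      with lim have "(\<lambda>k. 0::complex) \<longlonglongrightarrow> 1" by simp
      then show False by (simp add: LIMSEQ_const_iff)
    qed
    then show "\<exists>j. mask D (L (Suc j) l) = 0" using prod zero by auto
  next
    assume "\<exists>j. mask D (L (Suc j) l) = 0"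
    then obtain j where "mask D (L (Suc j) l) = 0" by blast
    then show "fourier \<mu> l = 0" using prod[of "Suc j"] by simp
  qed
  have iter: "l = ((*v) (transpose M) ^^ k) y \<longleftrightarrow> y = L k l" for k y
  proof -
    have inv: "invertible M" by (rule expanding_imp_invertible[OF exp])
    have c1: "transpose M *v (transpose (matrix_inv M) *v z) = z"
      and c2: "transpose (matrix_inv M) *v (transpose M *v z) = z" for z
      by (simp_all add: matrix_vector_mul_assoc matrix_inv_both[OF inv] transpose_mat
          del: transpose_matrix_vector flip: matrix_transpose_mul)
    have "((*v) (transpose M) ^^ k) (L k z) = z" "L k (((*v) (transpose M) ^^ k) z) = z" for z
      unfolding L_def by (induction k arbitrary: z) (simp_all add: c1 c2 funpow_swap1 del: transpose_matrix_vector)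
    then show ?thesis by metis
  qed
  show ?thesis unfolding zero iter by blast
qed

lemma fourier_minus: "fourier \<mu> (- l) = cnj (fourier \<mu> l)"
proof -
  have "expo (- l) x = cnj (expo l x)" for x
    by (simp add: expo_def exp_cnj)
  then have "fourier \<mu> (- l) = (LINT x|\<mu>. cnj (expo l x))"
    by (simp only: fourier_def)
  then show ?thesis by (simp only: Bochner_Integration.integral_cnj fourier_def)
qed

lemma fourier_zero_frequency: "prob_space \<mu> \<Longrightarrow> fourier \<mu> 0 = 1"
  by (simp add: fourier_def expo_def prob_space.prob_space)

section \<open>Integer vectors modulo a prime\<close>

definition vcong :: "nat \<Rightarrow> int ^ 'n \<Rightarrow> int ^ 'n \<Rightarrow> bool" where
  "vcong p x y \<longleftrightarrow> (\<forall>i. [x $ i = y $ i] (mod int p))"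

lemma vcong_refl [simp]: "vcong p x x"
  by (simp add: vcong_def)

lemma vcong_sym: "vcong p x y \<Longrightarrow> vcong p y x"
  by (simp add: vcong_def cong_sym_eq)

lemma vcong_trans [trans]: "vcong p x y \<Longrightarrow> vcong p y z \<Longrightarrow> vcong p x z"
  unfolding vcong_def using cong_trans by blast

lemma vcong_add: "vcong p x y \<Longrightarrow> vcong p x' y' \<Longrightarrow> vcong p (x + x') (y + y')"
  by (simp add: vcong_def cong_add)

lemma vcong_diff_0_iff: "vcong p (x - y) 0 \<longleftrightarrow> vcong p x y"
  by (simp add: vcong_def cong_diff_iff_cong_0)

lemma vcong_scale: "[a = b] (mod int p) \<Longrightarrow> vcong p x y \<Longrightarrow> vcong p (a *s x) (b *s y)"
  by (simp add: vcong_def cong_mult)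

lemma vcong_matrix_mult: "mat_cong p A B \<Longrightarrow> vcong p x y \<Longrightarrow> vcong p (A *v x) (B *v y)"
  by (auto simp: vcong_def mat_cong_def matrix_vector_mult_def intro!: cong_sum cong_mult)

lemma mat_cong_refl [simp]: "mat_cong p A A"
  by (simp add: mat_cong_def)

lemma mat_cong_sym: "mat_cong p A B \<Longrightarrow> mat_cong p B A"
  by (simp add: mat_cong_def cong_sym_eq)

lemma mat_cong_trans [trans]: "mat_cong p A B \<Longrightarrow> mat_cong p B C \<Longrightarrow> mat_cong p A C"
  unfolding mat_cong_def using cong_trans by blast

lemma mat_cong_mult: "mat_cong p A B \<Longrightarrow> mat_cong p C D \<Longrightarrow> mat_cong p (A ** C) (B ** D)"
  by (auto simp: mat_cong_def matrix_matrix_mult_def intro!: cong_sum cong_mult)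

lemma mat_cong_transpose: "mat_cong p A B \<Longrightarrow> mat_cong p (transpose A) (transpose B)"
  by (simp add: mat_cong_def transpose_def)

lemma mat_cong_det: "mat_cong p A B \<Longrightarrow> [det A = det B] (mod int p)"
  unfolding det_def mat_cong_def by (intro cong_sum cong_mult cong_prod) auto

lemma vcong_iterate: "vcong p x y \<Longrightarrow> vcong p (((*v) N ^^ k) x) (((*v) N ^^ k) y)"
  for N :: "int ^ 'n ^ 'n"
  by (induction k) (simp_all add: vcong_matrix_mult[OF mat_cong_refl])

lemma iterate_add: "((*v) N ^^ k) (x + y) = ((*v) N ^^ k) x + ((*v) N ^^ k) y"
  for N :: "int ^ 'n ^ 'n"
  by (induction k) (simp_all add: matrix_vector_right_distrib)

lemma iterate_diff: "((*v) N ^^ k) (x - y) = ((*v) N ^^ k) x - ((*v) N ^^ k) y"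
  for N :: "int ^ 'n ^ 'n"
  using iterate_add[of k N "x - y" y] by simp

lemma iterate_0: "((*v) N ^^ k) 0 = 0" for N :: "int ^ 'n ^ 'n"
  by (induction k) simp_all

lemma real_vec_matrix_mult: "real_vec (A *v x) = real_mat A *v real_vec x"
  by (simp add: vec_eq_iff matrix_vector_mult_def)

lemma real_vec_iterate: "real_vec (((*v) N ^^ k) x) = ((*v) (real_mat N) ^^ k) (real_vec x)"
  for N :: "int ^ 'n ^ 'n"
  by (induction k) (simp_all only: funpow.simps o_apply id_apply real_vec_matrix_mult)

lemma real_vec_eq_iff: "real_vec x = real_vec y \<longleftrightarrow> x = y"
  by (simp add: vec_eq_iff)

lemma real_mat_transpose: "real_mat (transpose A) = transpose (real_mat A)"
  by (simp add: vec_eq_iff transpose_def)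

lemma det_real_mat: "det (real_mat A) = of_int (det A)"
  by (simp add: det_def)

text \<open>
  Cramer's rule over the reals, read as an integrality statement: the numerator determinant has
  integer entries.
\<close>

lemma int_cramer:
  fixes H :: "int ^ 'n ^ 'n"
  assumes "real_mat H *v u = real_vec s"
  shows "u $ k * of_int (det H) = of_int (det (\<chi> i j. if j = k then s $ i else H $ i $ j))"
proof -
  have "u $ k * of_int (det H) = det (\<chi> i j. if j = k then (real_mat H *v u) $ i else real_mat H $ i $ j)"
    by (simp only: cramer_lemma det_real_mat)
  also have "(\<chi> i j. if j = k then (real_mat H *v u) $ i else real_mat H $ i $ j)
      = real_mat (\<chi> i j. if j = k then s $ i else H $ i $ j)"
    unfolding assms by (simp add: vec_eq_iff)
  finally show ?thesis by (simp only: det_real_mat)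
qed

lemma det_scale_integral:
  fixes H :: "int ^ 'n ^ 'n"
  assumes "real_mat H *v u = real_vec s"
  shows "\<exists>w. of_int (det H) *\<^sub>R u = real_vec w"
  using int_cramer[OF assms]
  by (intro exI[of _ "\<chi> k. det (\<chi> i j. if j = k then s $ i else H $ i $ j)"])
    (simp add: vec_eq_iff mult.commute)

text \<open>
  By Cramer's rule each coordinate of \<open>x\<close> times \<open>det N\<close> is a determinant
  with a column that is 0 modulo \<open>p\<close>.
\<close>

lemma matrix_mult_inj_mod:
  fixes N :: "int ^ 'n ^ 'n"
  assumes "prime p" and "\<not> int p dvd det N" and "vcong p (N *v x) 0"
  shows "vcong p x 0"
  unfolding vcong_def
proof
  fix k
  have cramer: "y $ k * det N = det (\<chi> i j. if j = k then (N *v y) $ i else N $ i $ j)" for y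
    using int_cramer[OF real_vec_matrix_mult[symmetric, of N y], of k]
    by (simp flip: of_int_mult)
  have "mat_cong p (\<chi> i j. if j = k then (N *v x) $ i else N $ i $ j)
      (\<chi> i j. if j = k then (N *v 0) $ i else N $ i $ j)"
    using assms(3) by (simp add: mat_cong_def vcong_def)
  from mat_cong_det[OF this] have "[x $ k * det N = 0] (mod int p)"
    unfolding cramer[symmetric] by simp
  then have "int p dvd x $ k * det N" by (simp add: cong_0_iff)
  then show "[x $ k = 0 $ k] (mod int p)"
    using assms prime_dvd_mult_iff[of "int p"] by (simp add: cong_0_iff)
qed

lemma iterate_inj_mod:
  fixes N :: "int ^ 'n ^ 'n"
  assumes "prime p" and "\<not> int p dvd det N" and "vcong p (((*v) N ^^ k) x) (((*v) N ^^ k) y)"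
  shows "vcong p x y"
proof -
  have "vcong p (((*v) N ^^ k) (x - y)) 0"
    using assms(3) by (simp only: iterate_diff vcong_diff_0_iff)
  then have "vcong p (x - y) 0"
  proof (induction k)
    case (Suc k)
    then show ?case
      using matrix_mult_inj_mod[OF assms(1,2)] by simp
  qed simp
  then show ?thesis by (simp only: vcong_diff_0_iff)
qed

definition vmod :: "nat \<Rightarrow> int ^ 'n \<Rightarrow> int ^ 'n" where
  "vmod p x = (\<chi> i. x $ i mod int p)"

lemma vmod_eq_iff: "vmod p x = vmod p y \<longleftrightarrow> vcong p x y"
  by (simp add: vmod_def vcong_def vec_eq_iff cong_def)

lemma vcong_vmod: "vcong p (vmod p x) x"
  by (simp add: vmod_def vcong_def cong_def)

lemma card_range_vmod:
  assumes "p > 0"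
  shows "finite (range (vmod p :: int ^ 'n \<Rightarrow> int ^ 'n))"
    and "card (range (vmod p :: int ^ 'n \<Rightarrow> int ^ 'n)) \<le> p ^ CARD('n)"
proof -
  let ?P = "PiE (UNIV :: 'n set) (\<lambda>_. {0..<int p})"
  have sub: "range (vmod p :: int ^ 'n \<Rightarrow> int ^ 'n) \<subseteq> vec_lambda ` ?P"
    using assms by (auto simp: vmod_def intro!: imageI)
  have fin: "finite ?P" by (intro finite_PiE) auto
  show "finite (range (vmod p :: int ^ 'n \<Rightarrow> int ^ 'n))"
    using finite_subset[OF sub] fin by simp
  have "card (range (vmod p :: int ^ 'n \<Rightarrow> int ^ 'n)) \<le> card (vec_lambda ` ?P)"
    using sub fin by (intro card_mono) auto
  also have "\<dots> \<le> card ?P" by (rule card_image_le[OF fin])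
  also have "\<dots> = p ^ CARD('n)" by (simp add: card_PiE)
  finally show "card (range (vmod p :: int ^ 'n \<Rightarrow> int ^ 'n)) \<le> p ^ CARD('n)" .
qed

text \<open>
  The powers of \<open>N\<close> act on a finite set of residues, so two of them agree; the smaller
  one can be cancelled because \<open>N\<close> is injective modulo \<open>p\<close>.
\<close>

lemma iterate_periodic_mod:
  fixes N :: "int ^ 'n ^ 'n"
  assumes p: "prime p" and det: "\<not> int p dvd det N"
  shows "\<exists>L>0. \<forall>q x. vcong p (((*v) N ^^ (L * q)) x) x"
proof -
  let ?R = "range (vmod p :: int ^ 'n \<Rightarrow> int ^ 'n)"
  have "p > 0" using p by (rule prime_gt_0_nat)
  define F where "F k = (\<lambda>v\<in>?R. vmod p (((*v) N ^^ k) v))" for k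
  have "range F \<subseteq> PiE ?R (\<lambda>_. ?R)" by (auto simp: F_def)
  then have "finite (range F)"
    using finite_PiE[of ?R "\<lambda>_. ?R"] card_range_vmod(1)[OF \<open>p > 0\<close>] finite_subset by blast
  then have "\<not> inj F" using finite_imageD infinite_UNIV_nat by blast
  then obtain a b where "F a = F b" "a \<noteq> b" by (auto simp: inj_def)
  then have "\<exists>a b. F a = F b \<and> a < b" by (metis linorder_neqE_nat)
  then obtain a b where ab: "F a = F b" "a < b" by blast
  have period: "vcong p (((*v) N ^^ (b - a)) x) x" for x
  proof (rule iterate_inj_mod[OF p det])
    have "((*v) N ^^ a) (((*v) N ^^ (b - a)) x) = ((*v) N ^^ b) x"
      using ab(2) by (simp flip: funpow_add o_apply[of "(*v) N ^^ a"])
    also have "vcong p \<dots> (((*v) N ^^ b) (vmod p x))"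
      by (intro vcong_iterate vcong_sym[OF vcong_vmod])
    also have "vcong p \<dots> (((*v) N ^^ a) (vmod p x))"
      using fun_cong[OF ab(1), of "vmod p x"] unfolding F_def restrict_apply'[OF rangeI] vmod_eq_iff
      by (rule vcong_sym)
    also have "vcong p \<dots> (((*v) N ^^ a) x)"
      by (intro vcong_iterate vcong_vmod)
    finally show "vcong p (((*v) N ^^ a) (((*v) N ^^ (b - a)) x)) (((*v) N ^^ a) x)" .
  qed
  have "vcong p (((*v) N ^^ ((b - a) * q)) x) x" for q x
  proof (induction q)
    case (Suc q)
    have "((*v) N ^^ ((b - a) * Suc q)) x = ((*v) N ^^ (b - a)) (((*v) N ^^ ((b - a) * q)) x)"
      by (simp add: funpow_add)
    also have "vcong p \<dots> (((*v) N ^^ ((b - a) * q)) x)" by (rule period)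
    also note Suc
    finally show ?case .
  qed simp
  then show ?thesis using ab(2) by (intro exI[of _ "b - a"]) auto
qed

section \<open>Cliques of residues\<close>

text \<open>
  \<open>N\<close>, \<open>G\<close> and \<open>S\<close> stand for \<open>M\<^sup>T\<close>,
  \<open>A\<^sup>T\<close> and the scaled zeros of the mask. This is the criterion for the existence
  of infinitely many orthogonal exponentials.
\<close>

definition nilpotent_digit ::
  "nat \<Rightarrow> int ^ 'n ^ 'n \<Rightarrow> int ^ 'n ^ 'n \<Rightarrow> (int ^ 'n) set \<Rightarrow> bool" where
  "nilpotent_digit p N G S \<longleftrightarrow> (\<exists>s\<in>S. \<exists>k. vcong p (((*v) N ^^ k) (G *v s)) 0)"

text \<open>
  A clique in the Cayley graph of the group of residues with connection set \<open>{N\<^sup>j G s |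
  s \<in> S}\<close>, represented by integer vectors. In the absence of a nilpotent digit the
  representatives are incongruent.
\<close>

definition residue_clique ::
  "nat \<Rightarrow> int ^ 'n ^ 'n \<Rightarrow> int ^ 'n ^ 'n \<Rightarrow> (int ^ 'n) set \<Rightarrow> (int ^ 'n) set \<Rightarrow> bool" where
  "residue_clique p N G S X \<longleftrightarrow>
     (\<forall>x\<in>X. \<forall>y\<in>X. x \<noteq> y \<longrightarrow> (\<exists>s\<in>S. \<exists>j. vcong p (x - y) (((*v) N ^^ j) (G *v s))))"

lemma residue_clique_incongruent:
  assumes "residue_clique p N G S X" "\<not> nilpotent_digit p N G S" "x \<in> X" "y \<in> X" "vcong p x y"
  shows "x = y"
proof (rule ccontr)
  assume "x \<noteq> y"
  then obtain s j where "s \<in> S" and sj: "vcong p (x - y) (((*v) N ^^ j) (G *v s))"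
    using assms unfolding residue_clique_def by blast
  have "vcong p (x - y) 0" using assms(5) by (simp only: vcong_diff_0_iff)
  then have "vcong p (((*v) N ^^ j) (G *v s)) 0"
    using sj vcong_sym vcong_trans by blast
  then show False
    using assms(2) \<open>s \<in> S\<close> unfolding nilpotent_digit_def by blast
qed

lemma residue_clique_finite:
  fixes X :: "(int ^ 'n) set"
  assumes "residue_clique p N G S X" "\<not> nilpotent_digit p N G S" "p > 0"
  shows "finite X" and "card X \<le> p ^ CARD('n)"
proof -
  have inj: "inj_on (vmod p) X"
    using residue_clique_incongruent[OF assms(1,2)] by (auto simp: inj_on_def vmod_eq_iff)
  have sub: "vmod p ` X \<subseteq> range (vmod p :: int ^ 'n \<Rightarrow> int ^ 'n)" by blast
  show "finite X"
    using finite_subset[OF sub card_range_vmod(1)[OF assms(3)]] inj finite_imageD by blast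
  show "card X \<le> p ^ CARD('n)"
    using card_mono[OF card_range_vmod(1)[OF assms(3)] sub] card_range_vmod(2)[OF assms(3), where 'n='n]
    unfolding card_image[OF inj] by (rule order_trans)
qed

lemma intertwined_iterate:
  assumes "mat_cong p (G ** N') (N ** G)"
  shows "vcong p (G *v ((*v) N' ^^ j) s) (((*v) N ^^ j) (G *v s))"
proof (induction j)
  case (Suc j)
  have "G *v ((*v) N' ^^ Suc j) s = (G ** N') *v (((*v) N' ^^ j) s)"
    by (simp add: matrix_vector_mul_assoc)
  also have "vcong p \<dots> ((N ** G) *v (((*v) N' ^^ j) s))"
    by (rule vcong_matrix_mult[OF assms vcong_refl])
  also have "(N ** G) *v (((*v) N' ^^ j) s) = N *v (G *v (((*v) N' ^^ j) s))"
    by (simp add: matrix_vector_mul_assoc)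
  also have "vcong p \<dots> (N *v (((*v) N ^^ j) (G *v s)))"
    by (rule vcong_matrix_mult[OF mat_cong_refl Suc])
  finally show ?case by simp
qed simp

lemma mat_cong_inverse_cancel:
  assumes "mat_cong p (H ** G) (mat 1)"
  shows "vcong p (H *v (G *v x)) x"
  using vcong_matrix_mult[OF assms vcong_refl, of x] by (simp add: matrix_vector_mul_assoc)

lemma nilpotent_digit_intertwined:
  assumes GN: "mat_cong p (G ** N') (N ** G)" and HG: "mat_cong p (H ** G) (mat 1)"
  shows "nilpotent_digit p N G S \<longleftrightarrow> nilpotent_digit p N' (mat 1) S"
proof -
  have "vcong p (((*v) N ^^ k) (G *v s)) 0 \<longleftrightarrow> vcong p (((*v) N' ^^ k) s) 0" for k s
  proof
    assume "vcong p (((*v) N ^^ k) (G *v s)) 0"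
    with intertwined_iterate[OF GN] have "vcong p (G *v ((*v) N' ^^ k) s) 0"
      by (rule vcong_trans)
    then have "vcong p (H *v (G *v ((*v) N' ^^ k) s)) (H *v 0)"
      by (rule vcong_matrix_mult[OF mat_cong_refl])
    with mat_cong_inverse_cancel[OF HG] show "vcong p (((*v) N' ^^ k) s) 0"
      using vcong_sym vcong_trans by (metis matrix_vector_mult_0_right)
  next
    assume "vcong p (((*v) N' ^^ k) s) 0"
    then have "vcong p (G *v ((*v) N' ^^ k) s) (G *v 0)"
      by (rule vcong_matrix_mult[OF mat_cong_refl])
    with intertwined_iterate[OF GN] show "vcong p (((*v) N ^^ k) (G *v s)) 0"
      using vcong_sym vcong_trans by (metis matrix_vector_mult_0_right)
  qed
  then show ?thesis by (simp add: nilpotent_digit_def)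
qed

text \<open>
  A matrix that is invertible modulo \<open>p\<close> and carries one connection set into the other
  is an embedding of Cayley graphs.
\<close>

lemma residue_clique_image:
  assumes clique: "residue_clique p N\<^sub>1 G\<^sub>1 S X" and nil: "\<not> nilpotent_digit p N\<^sub>1 G\<^sub>1 S"
    and QP: "mat_cong p (Q ** P) (mat 1)"
    and P: "\<And>j s. vcong p (P *v ((*v) N\<^sub>1 ^^ j) (G\<^sub>1 *v s)) (((*v) N\<^sub>2 ^^ j) (G\<^sub>2 *v s))"
  shows "residue_clique p N\<^sub>2 G\<^sub>2 S ((*v) P ` X)" and "ecard ((*v) P ` X) = ecard X"
proof -
  have "inj_on ((*v) P) X"
  proof (rule inj_onI)
    fix x y assume xy: "x \<in> X" "y \<in> X" "P *v x = P *v y"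
    have "vcong p x (Q *v (P *v y))"
      using vcong_sym[OF mat_cong_inverse_cancel[OF QP, of x]] xy(3) by simp
    then have "vcong p x y" using mat_cong_inverse_cancel[OF QP] vcong_trans by blast
    then show "x = y" using residue_clique_incongruent[OF clique nil] xy by blast
  qed
  then show "ecard ((*v) P ` X) = ecard X"
    by (simp add: ecard_def card_image finite_image_iff)
  show "residue_clique p N\<^sub>2 G\<^sub>2 S ((*v) P ` X)"
    unfolding residue_clique_def
  proof (clarsimp)
    fix x y assume "x \<in> X" "y \<in> X" "P *v x \<noteq> P *v y"
    moreover from this have "x \<noteq> y" by blast
    ultimately obtain s j where "s \<in> S" and sj: "vcong p (x - y) (((*v) N\<^sub>1 ^^ j) (G\<^sub>1 *v s))"
      using clique unfolding residue_clique_def by blast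
    have "vcong p (P *v (x - y)) (P *v (((*v) N\<^sub>1 ^^ j) (G\<^sub>1 *v s)))"
      by (rule vcong_matrix_mult[OF mat_cong_refl sj])
    also note P
    finally show "\<exists>s\<in>S. \<exists>j. vcong p (P *v x - P *v y) (((*v) N\<^sub>2 ^^ j) (G\<^sub>2 *v s))"
      using \<open>s \<in> S\<close> unfolding matrix_vector_mult_diff_distrib by blast
  qed
qed

lemma residue_clique_sizes_intertwined:
  assumes GN: "mat_cong p (G ** N') (N ** G)"
    and HG: "mat_cong p (H ** G) (mat 1)" and GH: "mat_cong p (G ** H) (mat 1)"
    and nil: "\<not> nilpotent_digit p N G S"
  shows "{ecard X | X. residue_clique p N G S X} = {ecard X | X. residue_clique p N' (mat 1) S X}"
proof -
  have nil': "\<not> nilpotent_digit p N' (mat 1) S"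
    using nil nilpotent_digit_intertwined[OF GN HG] by blast
  have G: "vcong p (G *v ((*v) N' ^^ j) (mat 1 *v s)) (((*v) N ^^ j) (G *v s))" for j s
    using intertwined_iterate[OF GN] by simp
  have H: "vcong p (H *v ((*v) N ^^ j) (G *v s)) (((*v) N' ^^ j) (mat 1 *v s))" for j s
  proof -
    have "vcong p (H *v ((*v) N ^^ j) (G *v s)) (H *v (G *v ((*v) N' ^^ j) s))"
      by (rule vcong_matrix_mult[OF mat_cong_refl vcong_sym[OF intertwined_iterate[OF GN]]])
    also have "vcong p \<dots> (((*v) N' ^^ j) s)" by (rule mat_cong_inverse_cancel[OF HG])
    finally show ?thesis by simp
  qed
  show ?thesis
    using residue_clique_image[OF _ nil GH H] residue_clique_image[OF _ nil' HG G]
    by (intro set_eqI iffI; clarsimp) metis+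
qed

section \<open>Zeros of the mask on the grid\<close>

lemma linear_iterate: "linear ((*v) R ^^ k)" for R :: "real ^ 'n ^ 'n"
proof (induction k)
  case (Suc k)
  show ?case unfolding funpow.simps by (intro linear_compose Suc matrix_vector_mul_linear)
qed (simp add: linear_id[unfolded id_def])

lemma mask_periodic:
  "mask (real_vec ` D) (x + real_vec v) = mask (real_vec ` D) x"
proof -
  have "expo (real_vec d) (x + real_vec v) = expo (real_vec d) x" for d
  proof -
    have "real_vec d \<bullet> real_vec v = of_int (\<Sum>i\<in>UNIV. d $ i * v $ i)"
      by (simp add: inner_vec_def)
    then have "expo (real_vec d) (real_vec v) = 1"
      unfolding expo_def exp_eq_1
      by (intro conjI exI[of _ "\<Sum>i\<in>UNIV. d $ i * v $ i"]) simp_all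
    then show ?thesis by (simp only: expo_add_right mult_1_right)
  qed
  then show ?thesis unfolding mask_def by (auto intro!: sum.cong)
qed

lemma not_dvd_det_if_inverse_mod:
  fixes B :: "int ^ 'n ^ 'n"
  assumes p: "prime p" and AB: "mat_cong p (A ** B) (mat 1)"
  shows "\<not> int p dvd det B"
proof
  assume "int p dvd det B"
  moreover have "[det A * det B = 1] (mod int p)"
    using mat_cong_det[OF AB] by (simp add: det_mul det_I)
  ultimately have "int p dvd 1"
    by (metis cong_dvd_iff dvd_mult)
  then show False using p by (auto dest: prime_gt_1_nat)
qed

lemma matrix_image_inj:
  fixes B :: "int ^ 'n ^ 'n"
  assumes "det B \<noteq> 0"
  shows "inj ((*v) B)"
proof (rule injI)
  fix x y assume "B *v x = B *v y"
  then have "real_mat B *v real_vec x = real_mat B *v real_vec y"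
    by (simp only: flip: real_vec_matrix_mult)
  moreover have "invertible (real_mat B)"
    using assms by (simp add: invertible_det_nz det_real_mat)
  ultimately show "x = y"
    using matrix_inv_cancel(2) by (metis real_vec_eq_iff)
qed

lemma mask_matrix_image:
  fixes B :: "int ^ 'n ^ 'n"
  assumes "det B \<noteq> 0"
  shows "mask (real_vec ` (\<lambda>d. B *v d) ` D) y = mask (real_vec ` D) (real_mat (transpose B) *v y)"
proof -
  have inj: "inj (real_vec :: int ^ 'n \<Rightarrow> real ^ 'n)"
    by (rule injI) (simp only: real_vec_eq_iff)
  have "expo (real_vec (B *v d)) y = expo (real_vec d) (real_mat (transpose B) *v y)" for d
    unfolding real_vec_matrix_mult real_mat_transpose
    by (subst (1 2) expo_commute) (simp only: expo_matrix_vector)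
  then show ?thesis
    unfolding mask_def
    using inj_on_subset[OF matrix_image_inj[OF assms] subset_UNIV, of D] inj_on_subset[OF inj subset_UNIV]
    by (simp add: card_image sum.reindex o_def)
qed

text \<open>
  The zeros of the mask on the lattice \<open>(1/p) \<int>\<^sup>n\<close>, scaled to integer
  vectors so that they can be treated modulo \<open>p\<close>.
\<close>

definition mask_zero_digits :: "nat \<Rightarrow> (int ^ 'n) set \<Rightarrow> (int ^ 'n) set" where
  "mask_zero_digits p D = {s. mask (real_vec ` D) ((1 / p) *\<^sub>R real_vec s) = 0}"

lemma mask_zero_digits_cong:
  assumes "p > 0" "vcong p s t" "s \<in> mask_zero_digits p D"
  shows "t \<in> mask_zero_digits p D"
proof -
  have "\<exists>v. \<forall>i. t $ i = s $ i + int p * v $ i"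
  proof -
    have "\<forall>i. \<exists>k. t $ i = s $ i + int p * k"
      using assms(2) by (simp add: vcong_def cong_iff_lin)
    then obtain k where "\<forall>i. t $ i = s $ i + int p * k i" by metis
    then show ?thesis by (intro exI[of _ "\<chi> i. k i"]) simp
  qed
  then obtain v where "\<forall>i. t $ i = s $ i + int p * v $ i" by blast
  then have "(1 / p) *\<^sub>R real_vec t = (1 / p) *\<^sub>R real_vec s + real_vec v"
    using assms(1) by (simp add: vec_eq_iff field_simps)
  then show ?thesis
    using assms(3) by (simp only: mask_zero_digits_def mem_Collect_eq mask_periodic)
qed

lemma mask_zero_digits_nonzero:
  fixes D :: "(int ^ 'n) set"
  assumes "p > 0" "finite D" "D \<noteq> {}" "s \<in> mask_zero_digits p D"
  shows "\<not> vcong p s 0"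
proof
  assume "vcong p s 0"
  then have "0 \<in> mask_zero_digits p D" using mask_zero_digits_cong assms by blast
  then have "mask (real_vec ` D) 0 = 0"
  proof -
    have "(1 / real p) *\<^sub>R real_vec 0 = (0 :: real ^ 'n)" by (simp add: vec_eq_iff)
    then show ?thesis
      using \<open>0 \<in> mask_zero_digits p D\<close> by (simp only: mask_zero_digits_def mem_Collect_eq)
  qed
  then show False using mask_zero[of "real_vec ` D"] assms by simp
qed

text \<open>
  Periodicity extends the grid hypothesis from the unit cube to all zeros of the mask.
\<close>

lemma mask_zero_imp_digit:
  assumes "p > 0" and zeros: "mask_zeros (real_vec ` D) \<subseteq> E_grid p"
    and "mask (real_vec ` D) y = 0"
  shows "\<exists>s\<in>mask_zero_digits p D. y = (1 / p) *\<^sub>R real_vec s"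
proof -
  define f where "f = (\<chi> i. \<lfloor>y $ i\<rfloor>)"
  define z where "z = y + real_vec (- f)"
  have "z \<in> mask_zeros (real_vec ` D)"
    using assms(3) mask_periodic[of D y "- f"]
    unfolding mask_zeros_def z_def by (auto simp: f_def) linarith
  then obtain l where l: "z = (1 / real p) *\<^sub>R real_vec l"
    using zeros by (auto simp: E_grid_def)
  have "y = (1 / p) *\<^sub>R real_vec (\<chi> i. l $ i + int p * f $ i)"
    using l assms(1) by (simp add: z_def vec_eq_iff field_simps)
  with assms(3) show ?thesis
    unfolding mask_zero_digits_def by blast
qed

text \<open>
  The zeros for \<open>D\<close> are the images under \<open>B\<^sup>T\<close> of the zeros for
  \<open>B D\<close>, and \<open>B\<^sup>T\<close> preserves the lattice \<open>(1/p)
  \<int>\<^sup>n\<close>; so the grid hypothesis for either digit set yields it for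
  \<open>D\<close>.
\<close>

lemma mask_zeros_subset_grid_transfer:
  fixes B :: "int ^ 'n ^ 'n"
  assumes "p > 0" and "det B \<noteq> 0"
    and zeros: "mask_zeros (real_vec ` (\<lambda>d. B *v d) ` D) \<subseteq> E_grid p"
  shows "mask_zeros (real_vec ` D) \<subseteq> E_grid p"
proof
  fix y assume y: "y \<in> mask_zeros (real_vec ` D)"
  then have y0: "mask (real_vec ` D) y = 0" and y1: "\<And>i. 0 \<le> y $ i \<and> y $ i < 1"
    by (auto simp: mask_zeros_def)
  have "invertible (real_mat (transpose B))"
    using assms(2) by (simp add: invertible_det_nz det_real_mat det_transpose)
  then have y2: "real_mat (transpose B) *v (matrix_inv (real_mat (transpose B)) *v y) = y"
    by (rule matrix_inv_cancel)
  then obtain s where s: "matrix_inv (real_mat (transpose B)) *v y = (1 / p) *\<^sub>R real_vec s"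
    using mask_zero_imp_digit[OF assms(1) zeros] y0 mask_matrix_image[OF assms(2)] by metis
  have y3: "y = (1 / p) *\<^sub>R real_vec (transpose B *v s)"
    unfolding real_vec_matrix_mult using y2 unfolding s by (simp only: matrix_vector_mult_scaleR)
  have "0 \<le> (transpose B *v s) $ i \<and> (transpose B *v s) $ i \<le> int p - 1" for i
  proof -
    have "y $ i = of_int ((transpose B *v s) $ i) / p"
      by (subst y3) simp
    then have "0 \<le> real_of_int ((transpose B *v s) $ i)" "real_of_int ((transpose B *v s) $ i) < real p"
      using y1[of i] assms(1) by (simp_all add: zero_le_divide_iff divide_less_eq)
    then show ?thesis by linarith
  qed
  then show "y \<in> E_grid p"
    unfolding E_grid_def using y3 by blast
qed

section \<open>Orthogonal frequencies as cliques\<close>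

text \<open>
  The measure of a pair of the form \<open>(M, B D)\<close>, described through the mask zeros of
  \<open>D\<close>. Both sides of a conjugacy have this form with the same \<open>D\<close>: one
  with the given \<open>A\<close> and \<open>B\<close>, the other with identity matrices.
\<close>

locale conjugated_digits =
  fixes p :: nat and M A B :: "int ^ 'n ^ 'n" and D :: "(int ^ 'n) set"
  assumes p: "prime p" and exp: "expanding (real_mat M)" and D: "finite D" "D \<noteq> {}"
    and AB: "mat_cong p (A ** B) (mat 1)" and BA: "mat_cong p (B ** A) (mat 1)"
    and zeros: "mask_zeros (real_vec ` D) \<subseteq> E_grid p"
begin

abbreviation "N \<equiv> transpose M"
abbreviation "G \<equiv> transpose A"
abbreviation "H \<equiv> transpose B"
abbreviation "S \<equiv> mask_zero_digits p D"
abbreviation "\<mu> \<equiv> self_affine_measure (real_mat M) (real_vec ` (\<lambda>d. B *v d) ` D)"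

lemma p_pos: "p > 0"
  using p by (rule prime_gt_0_nat)

lemma HG: "mat_cong p (H ** G) (mat 1)" and GH: "mat_cong p (G ** H) (mat 1)"
  using mat_cong_transpose[OF AB] mat_cong_transpose[OF BA]
  by (simp_all add: matrix_transpose_mul transpose_mat)

lemma det_B: "\<not> int p dvd det B" "det B \<noteq> 0"
  using not_dvd_det_if_inverse_mod[OF p AB] by auto

lemma self_affine: "is_self_affine_measure (real_mat M) (real_vec ` (\<lambda>d. B *v d) ` D) \<mu>"
  using D exp by (intro self_affine_measure_is_self_affine) auto

lemma prob_\<mu>: "prob_space \<mu>"
  by (rule is_self_affine_measureD[OF self_affine])

lemma fourier_zero_iff_digit:
  "fourier \<mu> l = 0 \<longleftrightarrow> (\<exists>j y. \<exists>s\<in>S. l = ((*v) (real_mat N) ^^ Suc j) y \<and> real_mat H *v y = (1 / p) *\<^sub>R real_vec s)"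
proof -
  have "fourier \<mu> l = 0 \<longleftrightarrow> (\<exists>j y. l = ((*v) (real_mat N) ^^ Suc j) y \<and> mask (real_vec ` D) (real_mat H *v y) = 0)"
    unfolding real_mat_transpose[of M] mask_matrix_image[OF det_B(2), symmetric]
    using D by (intro fourier_zero_iff[OF self_affine _ _ exp]) auto
  moreover have "mask (real_vec ` D) z = 0 \<longleftrightarrow> (\<exists>s\<in>S. z = (1 / p) *\<^sub>R real_vec s)" for z
    using mask_zero_imp_digit[OF p_pos zeros, of z] unfolding mask_zero_digits_def by blast
  ultimately show ?thesis by (simp only:) blast
qed

text \<open>
  A zero \<open>l\<close> of the transform is \<open>(M\<^sup>T)\<^sup>j y\<close> with
  \<open>B\<^sup>T y = s / p\<close>. The matrix \<open>B\<^sup>T\<close> may fail to be invertible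
  over the integers, but by Cramer's rule its determinant clears the denominators of
  \<open>y\<close> for all \<open>j\<close> at once, and modulo \<open>p\<close> the inverse of
  \<open>B\<^sup>T\<close> is \<open>A\<^sup>T\<close>.
\<close>

lemma fourier_zero_integral:
  "\<exists>c. c \<noteq> 0 \<and> (\<forall>l. fourier \<mu> l = 0 \<longrightarrow>
     (\<exists>v. \<exists>s\<in>S. \<exists>j. c *\<^sub>R l = real_vec v \<and> vcong p v (((*v) N ^^ j) (G *v s))))"
proof -
  define b where "b = det H"
  have "\<not> int p dvd b" using det_B by (simp add: b_def det_transpose)
  then have "coprime b (int p)"
    using p by (metis coprime_commute prime_imp_coprime prime_nat_int_transfer)
  then obtain b' where b': "[b * b' = 1] (mod int p)"
    using cong_solve_coprime_int by blast
  have "b * b' \<noteq> 0"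
  proof
    assume "b * b' = 0"
    then have "[0 = 1] (mod int p)" using b' by (simp only:)
    then show False using p by (auto simp: cong_iff_dvd_diff dest: prime_gt_1_nat)
  qed
  (* p and b = det H clear denominators; b' undoes the factor b modulo p. *)
  define c where "c = real p * of_int (b * b')"
  have "c \<noteq> 0" using \<open>b * b' \<noteq> 0\<close> p_pos by (simp add: c_def)
  moreover have "\<exists>v. \<exists>s\<in>S. \<exists>j. c *\<^sub>R l = real_vec v \<and> vcong p v (((*v) N ^^ j) (G *v s))"
    if zero: "fourier \<mu> l = 0" for l
  proof -
    obtain j y s where s: "s \<in> S" and l: "l = ((*v) (real_mat N) ^^ Suc j) y"
      and y: "real_mat H *v y = (1 / p) *\<^sub>R real_vec s"
      using zero unfolding fourier_zero_iff_digit by blast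
    have py: "real_mat H *v (p *\<^sub>R y) = real_vec s"
      using p_pos by (simp add: matrix_vector_mult_scaleR y)
    then obtain w where w: "of_int b *\<^sub>R (p *\<^sub>R y) = real_vec w"
      using det_scale_integral unfolding b_def by blast
    have "real_vec (H *v w) = of_int b *\<^sub>R (real_mat H *v (p *\<^sub>R y))"
      unfolding real_vec_matrix_mult w[symmetric] by (rule matrix_vector_mult_scaleR)
    also have "\<dots> = real_vec (b *s s)"
      unfolding py by (simp add: vec_eq_iff)
    finally have Hw: "H *v w = b *s s" by (simp only: real_vec_eq_iff)
    have "vcong p (b' *s w) (b' *s (G *v (H *v w)))"
      by (intro vcong_scale cong_refl vcong_sym[OF mat_cong_inverse_cancel[OF GH]])
    also have "b' *s (G *v (H *v w)) = (b * b') *s (G *v s)"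
      unfolding Hw by (simp add: vec_eq_iff matrix_vector_mult_def sum_distrib_left mult_ac)
    also have "vcong p \<dots> (1 *s (G *v s))"
      by (rule vcong_scale[OF b' vcong_refl])
    finally have "vcong p (b' *s w) (G *v s)" by simp
    then have "vcong p (((*v) N ^^ Suc j) (b' *s w)) (((*v) N ^^ Suc j) (G *v s))"
      by (rule vcong_iterate)
    moreover have "c *\<^sub>R l = real_vec (((*v) N ^^ Suc j) (b' *s w))"
    proof -
      have "c *\<^sub>R l = ((*v) (real_mat N) ^^ Suc j) (c *\<^sub>R y)"
        unfolding l by (rule linear_scale[OF linear_iterate, symmetric])
      also have "c *\<^sub>R y = real_vec (b' *s w)"
        using arg_cong[OF w, of "\<lambda>z. of_int b' *\<^sub>R z"] by (simp add: c_def vec_eq_iff mult_ac)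
      finally show ?thesis by (simp only: real_vec_iterate)
    qed
    ultimately show ?thesis using s by blast
  qed
  ultimately show ?thesis by blast
qed

text \<open>
  A partial converse of the preceding lemma. It holds for exact images under \<open>N ^^ Suc
  j\<close>, not for everything congruent to them, which is why the two constructions of orthogonal
  sets below start from high powers of \<open>N\<close>.
\<close>

lemma fourier_zeroI:
  assumes s: "s \<in> S" and v: "vcong p v (G *v s)"
  shows "fourier \<mu> ((1 / p) *\<^sub>R real_vec (((*v) N ^^ Suc j) v)) = 0"
proof -
  have "vcong p (H *v v) (H *v (G *v s))"
    by (rule vcong_matrix_mult[OF mat_cong_refl v])
  also have "vcong p \<dots> s" by (rule mat_cong_inverse_cancel[OF HG])
  finally have "H *v v \<in> S" using mask_zero_digits_cong[OF p_pos] s vcong_sym by blast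
  moreover have "real_mat H *v ((1 / p) *\<^sub>R real_vec v) = (1 / p) *\<^sub>R real_vec (H *v v)"
    unfolding real_vec_matrix_mult by (rule matrix_vector_mult_scaleR)
  moreover have "(1 / p) *\<^sub>R real_vec (((*v) N ^^ Suc j) v) = ((*v) (real_mat N) ^^ Suc j) ((1 / p) *\<^sub>R real_vec v)"
  proof -
    show ?thesis
      unfolding real_vec_iterate by (rule linear_scale[OF linear_iterate, symmetric])
  qed
  ultimately show ?thesis unfolding fourier_zero_iff_digit by blast
qed

text \<open>
  Translate one frequency to 0 and scale by the common denominator.
\<close>

lemma orthogonal_imp_clique:
  assumes "orthogonal_set \<mu> (E \<Lambda>)"
  shows "\<exists>f. bij_betw f \<Lambda> (f ` \<Lambda>) \<and> residue_clique p N G S (f ` \<Lambda>)"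
proof (cases "\<Lambda> = {}")
  case False
  then obtain l0 where "l0 \<in> \<Lambda>" by blast
  obtain c where "c \<noteq> 0" and c: "\<And>l. fourier \<mu> l = 0 \<Longrightarrow>
      \<exists>v. \<exists>s\<in>S. \<exists>j. c *\<^sub>R l = real_vec v \<and> vcong p v (((*v) N ^^ j) (G *v s))"
    using fourier_zero_integral by blast
  have diff: "fourier \<mu> (l - l') = 0" if "l \<in> \<Lambda>" "l' \<in> \<Lambda>" "l \<noteq> l'" for l l'
    using assms that unfolding orthogonal_set_E_iff by blast
  have "\<exists>v. c *\<^sub>R (l - l0) = real_vec v" if "l \<in> \<Lambda>" for l
  proof (cases "l = l0")
    case True
    then show ?thesis by (intro exI[of _ 0]) (simp add: vec_eq_iff)
  next
    case False
    then show ?thesis using c[OF diff[OF that \<open>l0 \<in> \<Lambda>\<close>]] by blast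
  qed
  then obtain f where f: "\<And>l. l \<in> \<Lambda> \<Longrightarrow> c *\<^sub>R (l - l0) = real_vec (f l)" by metis
  have fd: "c *\<^sub>R (l - l') = real_vec (f l - f l')" if "l \<in> \<Lambda>" "l' \<in> \<Lambda>" for l l'
  proof -
    have "c *\<^sub>R (l - l') = c *\<^sub>R (l - l0) - c *\<^sub>R (l' - l0)" by (simp add: scaleR_diff_right)
    then show ?thesis unfolding f[OF that(1)] f[OF that(2)] by (simp add: vec_eq_iff)
  qed
  have "inj_on f \<Lambda>"
  proof (rule inj_onI)
    fix l l' assume "l \<in> \<Lambda>" "l' \<in> \<Lambda>" "f l = f l'"
    then have "c *\<^sub>R (l - l') = 0" using fd by (simp add: vec_eq_iff)
    then show "l = l'" using \<open>c \<noteq> 0\<close> by simp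
  qed
  moreover have "residue_clique p N G S (f ` \<Lambda>)"
    unfolding residue_clique_def
  proof clarify
    fix l l' assume l: "l \<in> \<Lambda>" "l' \<in> \<Lambda>" "f l \<noteq> f l'"
    then have "l \<noteq> l'" by blast
    then obtain v s j where "s \<in> S" and v: "c *\<^sub>R (l - l') = real_vec v"
      and cong: "vcong p v (((*v) N ^^ j) (G *v s))"
      using c[OF diff[OF l(1,2)]] by blast
    have "v = f l - f l'" using v fd[OF l(1,2)] by (simp only: real_vec_eq_iff)
    then show "\<exists>s\<in>S. \<exists>j. vcong p (f l - f l') (((*v) N ^^ j) (G *v s))"
      using cong \<open>s \<in> S\<close> by blast
  qed
  ultimately show ?thesis by (blast intro: inj_on_imp_bij_betw)
qed (simp add: residue_clique_def bij_betw_def)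

lemma infinite_imp_nilpotent:
  assumes "has_infinite_orthogonal_exponentials \<mu>"
  shows "nilpotent_digit p N G S"
proof (rule ccontr)
  assume nil: "\<not> nilpotent_digit p N G S"
  obtain \<Lambda> where \<Lambda>: "infinite \<Lambda>" "orthogonal_set \<mu> (E \<Lambda>)"
    using assms by (auto simp: has_infinite_orthogonal_exponentials_def)
  obtain f where f: "bij_betw f \<Lambda> (f ` \<Lambda>)" "residue_clique p N G S (f ` \<Lambda>)"
    using orthogonal_imp_clique[OF \<Lambda>(2)] by blast
  then show False
    using residue_clique_finite(1)[OF f(2) nil p_pos] bij_betw_finite[OF f(1)] \<Lambda>(1) by blast
qed

text \<open>
  Let \<open>P\<close> be a power of \<open>N\<close> that kills \<open>w = G s\<close> modulo
  \<open>p\<close>. The frequencies are the partial sums of \<open>w + P w + P\<^sup>2 w +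
  \<dots>\<close>, multiplied by \<open>N / p\<close>. The difference of two of them is \<open>N
  P\<^sup>l\<close> applied to a shorter partial sum, and every nonempty partial sum is congruent to
  \<open>w\<close>.
\<close>

lemma nilpotent_imp_infinite:
  assumes "nilpotent_digit p N G S"
  shows "has_infinite_orthogonal_exponentials \<mu>"
proof -
  obtain s k where s: "s \<in> S" and "vcong p (((*v) N ^^ k) (G *v s)) 0"
    using assms by (auto simp: nilpotent_digit_def)
  define w where "w = G *v s"
  (* Suc k rather than k gives the uniform shape N ^^ Suc (Suc k * l) below. *)
  define P where "P = ((*v) N ^^ Suc k)"
  have Pw: "vcong p (P w) 0"
    using vcong_matrix_mult[OF mat_cong_refl \<open>vcong p (((*v) N ^^ k) (G *v s)) 0\<close>, of N]
    by (simp add: P_def w_def)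
  have P_cong: "vcong p (P x) (P y)" if "vcong p x y" for x y
    unfolding P_def using that by (rule vcong_iterate)
  have P_0: "P 0 = 0" unfolding P_def by (rule iterate_0)
  have P_add: "P (x + y) = P x + P y" for x y unfolding P_def by (rule iterate_add)
  have P_diff: "P (x - y) = P x - P y" for x y unfolding P_def by (rule iterate_diff)
  define X where "X i = ((\<lambda>x. w + P x) ^^ i) 0" for i
  have X_Suc: "X (Suc i) = w + P (X i)" for i by (simp add: X_def)
  have PX: "vcong p (P (X i)) 0" for i
  proof (induction i)
    case (Suc i)
    have "vcong p (P w + P (P (X i))) (0 + P 0)"
      by (intro vcong_add Pw P_cong Suc)
    then show ?case by (simp add: X_Suc P_add P_0)
  qed (simp add: X_def P_0)
  have X_w: "vcong p (X (Suc m)) (G *v s)" for m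
    using vcong_add[OF vcong_refl[of p w] PX[of m]] by (simp add: X_Suc w_def)
  have shift: "X (l + m) - X l = (P ^^ l) (X m)" for l m
  proof (induction l)
    case (Suc l)
    have "X (Suc l + m) - X (Suc l) = P (X (l + m) - X l)"
      by (simp add: X_Suc P_diff)
    then show ?case by (simp add: Suc)
  qed (simp add: X_def)
  define freq where "freq i = (1 / real p) *\<^sub>R real_vec (N *v X i)" for i
  have zero: "fourier \<mu> (freq (l + Suc m) - freq l) = 0" for l m
  proof -
    have "freq (l + Suc m) - freq l = (1 / real p) *\<^sub>R real_vec (N *v (X (l + Suc m) - X l))"
      by (simp only: freq_def matrix_vector_mult_diff_distrib scaleR_diff_right[symmetric])
        (simp add: vec_eq_iff)
    also have "N *v (X (l + Suc m) - X l) = ((*v) N ^^ Suc (Suc k * l)) (X (Suc m))"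
    proof -
      have "P ^^ l = (*v) N ^^ (Suc k * l)" unfolding P_def by (rule funpow_mult)
      then show ?thesis by (simp only: shift funpow.simps(2)[where n = "Suc k * l"] o_apply)
    qed
    finally show ?thesis using fourier_zeroI[OF s X_w] by simp
  qed
  have zero': "fourier \<mu> (freq i - freq j) = 0" if ne: "i \<noteq> j" for i j
  proof (cases "i < j")
    case True
    then obtain m where "j = i + Suc m" using less_imp_Suc_add[of i j] by auto
    then have "fourier \<mu> (- (freq j - freq i)) = 0"
      unfolding fourier_minus using zero[of i m] by simp
    then show ?thesis by simp
  next
    case False
    then obtain m where "i = j + Suc m"
      using False ne less_imp_Suc_add[of j i] by auto
    then show ?thesis using zero[of j m] by simp
  qed
  have "inj freq"
  proof (rule injI, rule ccontr)
    fix i j assume "freq i = freq j" "i \<noteq> j"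
    then have "fourier \<mu> 0 = 0" using zero'[of i j] by simp
    then show False using fourier_zero_frequency[OF prob_\<mu>] by simp
  qed
  then have "infinite (range freq)" by (rule range_inj_infinite)
  moreover have "countable (range freq)" by (rule countable_image[OF countableI_type])
  moreover have "orthogonal_set \<mu> (E (range freq))"
    unfolding orthogonal_set_E_iff
  proof (intro ballI impI)
    fix x y assume "x \<in> range freq" "y \<in> range freq" "x \<noteq> y"
    then obtain i j where ij: "x = freq i" "y = freq j" "i \<noteq> j" by blast
    show "fourier \<mu> (x - y) = 0" unfolding ij(1,2) by (rule zero'[OF ij(3)])
  qed
  ultimately show ?thesis
    unfolding has_infinite_orthogonal_exponentials_def by (intro exI[of _ "range freq"] conjI)
qed

lemma not_nilpotent:
  assumes "\<not> int p dvd det M"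
  shows "\<not> nilpotent_digit p N G S"
proof
  assume "nilpotent_digit p N G S"
  then obtain s k where s: "s \<in> S" "vcong p (((*v) N ^^ k) (G *v s)) 0"
    by (auto simp: nilpotent_digit_def)
  have det: "\<not> int p dvd det N" using assms by (simp add: det_transpose)
  have "vcong p (G *v s) 0"
    by (rule iterate_inj_mod[OF p det, of k]) (simp only: iterate_0 s(2))
  then have "vcong p (H *v (G *v s)) (H *v 0)" by (rule vcong_matrix_mult[OF mat_cong_refl])
  then have "vcong p s 0"
    using vcong_trans[OF vcong_sym[OF mat_cong_inverse_cancel[OF HG, of s]]]
    unfolding matrix_vector_mult_0_right by blast
  then show False using mask_zero_digits_nonzero[OF p_pos D s(1)] by blast
qed

text \<open>
  Apply a high power of \<open>N\<close> that is the identity modulo \<open>p\<close> and divide by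
  \<open>p\<close>. A difference that was congruent to \<open>N\<^sup>j G s\<close> then becomes an
  exact image under \<open>N\<^sup>j\<close> (and at least one further factor \<open>N\<close>) of a
  vector congruent to \<open>G s\<close>.
\<close>

lemma clique_imp_orthogonal:
  assumes det: "\<not> int p dvd det M" and X: "finite X" "residue_clique p N G S X"
  shows "\<exists>\<Lambda>. finite \<Lambda> \<and> card \<Lambda> = card X \<and> orthogonal_set \<mu> (E \<Lambda>)"
proof -
  define j where "j x y = (SOME j. \<exists>s\<in>S. vcong p (x - y) (((*v) N ^^ j) (G *v s)))" for x y
  have j: "\<exists>s\<in>S. vcong p (x - y) (((*v) N ^^ j x y) (G *v s))" if "x \<in> X" "y \<in> X" "x \<noteq> y" for x y
  proof -
    have "\<exists>j. \<exists>s\<in>S. vcong p (x - y) (((*v) N ^^ j) (G *v s))"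
      using X(2) that unfolding residue_clique_def by blast
    then show ?thesis unfolding j_def by (rule someI_ex)
  qed
  obtain L where L: "L > 0" "\<And>q x. vcong p (((*v) N ^^ (L * q)) x) x"
  proof -
    have "\<not> int p dvd det N" using det unfolding det_transpose .
    then show ?thesis using iterate_periodic_mod[OF p] that by blast
  qed
  define J where "J = (\<Sum>x\<in>X. \<Sum>y\<in>X. j x y)"
  have J: "j x y \<le> J" if "x \<in> X" "y \<in> X" for x y
  proof -
    have "j x y \<le> (\<Sum>y\<in>X. j x y)"
      using member_le_sum[of y X "j x"] that X(1) by simp
    also have "\<dots> \<le> J"
      unfolding J_def using member_le_sum[of x X "\<lambda>x. \<Sum>y\<in>X. j x y"] that X(1) by simp
    finally show ?thesis .
  qed
  (* One factor N ^^ L guarantees a positive exponent of N, another covers all exponents j up to J. *)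
  define T where "T = L * Suc (Suc J)"
  define freq where "freq x = (1 / real p) *\<^sub>R real_vec (((*v) N ^^ T) x)" for x
  have zero: "fourier \<mu> (freq x - freq y) = 0" if xy: "x \<in> X" "y \<in> X" "x \<noteq> y" for x y
  proof -
    let ?j = "j x y"
    obtain s where s: "s \<in> S" "vcong p (x - y) (((*v) N ^^ ?j) (G *v s))"
      using j[OF xy] by blast
    define v where "v = ((*v) N ^^ (L * Suc J - ?j)) (x - y)"
    have le: "?j \<le> L * Suc J"
    proof -
      have "?j \<le> Suc J" using J[OF xy(1,2)] by simp
      also have "\<dots> \<le> L * Suc J" using L(1) by (cases L) auto
      finally show ?thesis .
    qed
    have "vcong p v (((*v) N ^^ (L * Suc J - ?j)) (((*v) N ^^ ?j) (G *v s)))"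
      unfolding v_def by (rule vcong_iterate[OF s(2)])
    also have "((*v) N ^^ (L * Suc J - ?j)) (((*v) N ^^ ?j) (G *v s)) = ((*v) N ^^ (L * Suc J)) (G *v s)"
      using funpow_add[of "L * Suc J - ?j" ?j "(*v) N"] unfolding le_add_diff_inverse2[OF le] by (simp only: o_apply)
    also have "vcong p \<dots> (G *v s)" by (rule L(2))
    finally have v: "vcong p v (G *v s)" .
    obtain i where i: "L + ?j = Suc i" using L(1) by (cases L) auto
    have "((*v) N ^^ Suc i) v = ((*v) N ^^ T) (x - y)"
    proof -
      have "T = L + L * Suc J" by (simp add: T_def)
      then have T: "T = Suc i + (L * Suc J - ?j)" using le i by linarith
      show ?thesis unfolding v_def T funpow_add o_apply ..
    qed
    then have "freq x - freq y = (1 / real p) *\<^sub>R real_vec (((*v) N ^^ Suc i) v)"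
      by (simp only: freq_def iterate_diff scaleR_diff_right[symmetric]) (simp add: vec_eq_iff)
    then show ?thesis using fourier_zeroI[OF s(1) v] by (simp only:)
  qed
  have "inj_on freq X"
  proof (rule inj_onI, rule ccontr)
    fix x y assume "x \<in> X" "y \<in> X" "freq x = freq y" "x \<noteq> y"
    then have "fourier \<mu> 0 = 0" using zero[of x y] by simp
    then show False using fourier_zero_frequency[OF prob_\<mu>] by simp
  qed
  then have "card (freq ` X) = card X" by (rule card_image)
  moreover have "orthogonal_set \<mu> (E (freq ` X))"
    unfolding orthogonal_set_E_iff
  proof clarify
    fix x y assume xy: "x \<in> X" "y \<in> X" "freq x \<noteq> freq y"
    then have "x \<noteq> y" by blast
    then show "fourier \<mu> (freq x - freq y) = 0" by (rule zero[OF xy(1,2)])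
  qed
  ultimately show ?thesis using X(1) by blast
qed

text \<open>
  Orthogonal sets have bounded size, so each of them lies in one of largest size, which is maximal
  for inclusion; hence \<open>n_star\<close> is the supremum of the sizes of all orthogonal sets,
  which are the sizes of cliques by \<open>orthogonal_imp_clique\<close> and
  \<open>clique_imp_orthogonal\<close>.
\<close>

lemma n_star_eq_clique_number:
  assumes det: "\<not> int p dvd det M"
  shows "n_star \<mu> = Sup {ecard X | X. residue_clique p N G S X}"
    and "n_star \<mu> \<le> enat (p ^ CARD('n))"
proof -
  note nil = not_nilpotent[OF det]
  have to_clique: "\<exists>X. residue_clique p N G S X \<and> finite \<Lambda> \<and> ecard \<Lambda> = ecard X \<and> card \<Lambda> \<le> p ^ CARD('n)"
    if orth: "orthogonal_set \<mu> (E \<Lambda>)" for \<Lambda>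
  proof -
    obtain f where f: "bij_betw f \<Lambda> (f ` \<Lambda>)" "residue_clique p N G S (f ` \<Lambda>)"
      using orthogonal_imp_clique[OF orth] by blast
    note fin = residue_clique_finite[OF f(2) nil p_pos]
    have "finite \<Lambda>" "card \<Lambda> = card (f ` \<Lambda>)"
      using bij_betw_finite[OF f(1)] bij_betw_same_card[OF f(1)] fin by auto
    then show ?thesis using f(2) fin by (intro exI[of _ "f ` \<Lambda>"]) (simp add: ecard_def)
  qed
  show le: "n_star \<mu> \<le> enat (p ^ CARD('n))"
    unfolding n_star_def
  proof (rule Sup_least, clarify)
    fix \<Lambda> assume "maximal_orthogonal_exponentials \<mu> \<Lambda>"
    then have "orthogonal_set \<mu> (E \<Lambda>)" by (simp add: maximal_orthogonal_exponentials_def)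
    from to_clique[OF this] show "ecard \<Lambda> \<le> enat (p ^ CARD('n))" by (auto simp: ecard_def)
  qed
  show "n_star \<mu> = Sup {ecard X | X. residue_clique p N G S X}"
  proof (rule antisym)
    show "n_star \<mu> \<le> Sup {ecard X | X. residue_clique p N G S X}"
      unfolding n_star_def
    proof (rule Sup_least, clarify)
      fix \<Lambda> assume "maximal_orthogonal_exponentials \<mu> \<Lambda>"
      then have "orthogonal_set \<mu> (E \<Lambda>)" by (simp add: maximal_orthogonal_exponentials_def)
      from to_clique[OF this] show "ecard \<Lambda> \<le> Sup {ecard X | X. residue_clique p N G S X}"
        by (auto intro!: Sup_upper)
    qed
    show "Sup {ecard X | X. residue_clique p N G S X} \<le> n_star \<mu>"
    proof (rule Sup_least, clarify)
      fix X assume X: "residue_clique p N G S X"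
      note finX = residue_clique_finite(1)[OF X nil p_pos]
      obtain \<Lambda>\<^sub>0 where \<Lambda>\<^sub>0: "finite \<Lambda>\<^sub>0" "card \<Lambda>\<^sub>0 = card X" "orthogonal_set \<mu> (E \<Lambda>\<^sub>0)"
        using clique_imp_orthogonal[OF det finX X] by blast
      let ?Q = "\<lambda>\<Lambda>. \<Lambda>\<^sub>0 \<subseteq> \<Lambda> \<and> orthogonal_set \<mu> (E \<Lambda>)"
      have "\<exists>\<Lambda>. ?Q \<Lambda> \<and> (\<forall>\<Lambda>'. ?Q \<Lambda>' \<longrightarrow> card \<Lambda>' \<le> card \<Lambda>)"
      proof (rule ex_has_greatest_nat[of ?Q \<Lambda>\<^sub>0 card "Suc (p ^ CARD('n))"])
        show "?Q \<Lambda>\<^sub>0" using \<Lambda>\<^sub>0(3) by blast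
        show "\<forall>\<Lambda>. ?Q \<Lambda> \<longrightarrow> card \<Lambda> < Suc (p ^ CARD('n))"
          using to_clique le_imp_less_Suc by blast
      qed
      then obtain \<Lambda> where \<Lambda>: "\<Lambda>\<^sub>0 \<subseteq> \<Lambda>" "orthogonal_set \<mu> (E \<Lambda>)"
        and max: "\<And>\<Lambda>'. \<Lambda>\<^sub>0 \<subseteq> \<Lambda>' \<Longrightarrow> orthogonal_set \<mu> (E \<Lambda>') \<Longrightarrow> card \<Lambda>' \<le> card \<Lambda>"
        by blast
      have fin: "finite \<Lambda>" using to_clique[OF \<Lambda>(2)] by blast
      have "\<Lambda>' = \<Lambda>" if "\<Lambda> \<subseteq> \<Lambda>'" "orthogonal_set \<mu> (E \<Lambda>')" for \<Lambda>'
      proof (rule card_seteq[symmetric])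
        show "finite \<Lambda>'" using to_clique[OF that(2)] by blast
        show "card \<Lambda>' \<le> card \<Lambda>" using that \<Lambda>(1) by (intro max) auto
      qed (fact that(1))
      then have "maximal_orthogonal_exponentials \<mu> \<Lambda>"
        unfolding maximal_orthogonal_exponentials_def using \<Lambda>(2) by blast
      then have "ecard \<Lambda> \<le> n_star \<mu>"
        unfolding n_star_def using countable_finite[OF fin] by (intro Sup_upper) blast
      moreover have "ecard X \<le> ecard \<Lambda>"
        using card_mono[OF fin \<Lambda>(1)] \<Lambda>\<^sub>0(2) fin finX by (simp add: ecard_def)
      ultimately show "ecard X \<le> n_star \<mu>" by (rule order_trans[rotated])
    qed
  qed
qed

end

section \<open>Invariance under conjugacy\<close>

text \<open>
  Modulo \<open>p\<close>, \<open>A\<^sup>T M'\<^sup>T = M\<^sup>T A\<^sup>T\<close>. The hypothesis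
  on \<open>M'\<close> is only a congruence, so that the second form of conjugacy can be treated by
  exchanging the two pairs.
\<close>

lemma conjugate_measures:
  fixes M M' A B :: "int ^ 'n ^ 'n"
  assumes p: "prime p" and exp: "expanding (real_mat M)" "expanding (real_mat M')"
    and D: "finite D" "D \<noteq> {}"
    and AB: "mat_cong p (A ** B) (mat 1)" "mat_cong p (B ** A) (mat 1)"
    and M': "mat_cong p M' (A ** M ** B)"
    and zeros: "mask_zeros (real_vec ` D) \<subseteq> E_grid p"
  defines "\<mu> \<equiv> self_affine_measure (real_mat M) (real_vec ` (\<lambda>d. B *v d) ` D)"
    and "\<mu>' \<equiv> self_affine_measure (real_mat M') (real_vec ` D)"
  shows "has_infinite_orthogonal_exponentials \<mu> \<longleftrightarrow> has_infinite_orthogonal_exponentials \<mu>'"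
    and "\<not> int p dvd det M \<Longrightarrow> n_star \<mu> = n_star \<mu>' \<and> n_star \<mu>' \<le> enat (p ^ CARD('n))"
proof -
  have id: "(\<lambda>d. mat 1 *v d) ` D = D" by simp
  interpret P: conjugated_digits p M A B D
    by (unfold_locales) (fact p exp D AB zeros)+
  interpret P': conjugated_digits p M' "mat 1" "mat 1" D
    by (unfold_locales) (use p exp D zeros in simp_all)
  have BM: "mat_cong p (M' ** A) (A ** M)"
  proof -
    have "mat_cong p (M' ** A) ((A ** M ** B) ** A)"
      by (rule mat_cong_mult[OF M' mat_cong_refl])
    also have "(A ** M ** B) ** A = (A ** M) ** (B ** A)" by (simp add: matrix_mul_assoc)
    also have "mat_cong p \<dots> ((A ** M) ** mat 1)"
      by (rule mat_cong_mult[OF mat_cong_refl AB(2)])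
    finally show ?thesis by simp
  qed
  have GN: "mat_cong p (transpose A ** transpose M') (transpose M ** transpose A)"
    using mat_cong_transpose[OF BM] by (simp only: matrix_transpose_mul)
  note nilpotent = nilpotent_digit_intertwined[OF GN P.HG]
  have "has_infinite_orthogonal_exponentials \<mu> \<longleftrightarrow> nilpotent_digit p P.N P.G P.S"
    unfolding \<mu>_def using P.infinite_imp_nilpotent P.nilpotent_imp_infinite by blast
  moreover have "has_infinite_orthogonal_exponentials \<mu>' \<longleftrightarrow> nilpotent_digit p P'.N (mat 1) P.S"
    unfolding \<mu>'_def using P'.infinite_imp_nilpotent P'.nilpotent_imp_infinite
    unfolding id transpose_mat by blast
  ultimately show "has_infinite_orthogonal_exponentials \<mu> \<longleftrightarrow> has_infinite_orthogonal_exponentials \<mu>'"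
    using nilpotent by blast
  show "n_star \<mu> = n_star \<mu>' \<and> n_star \<mu>' \<le> enat (p ^ CARD('n))" if det: "\<not> int p dvd det M"
  proof -
    have "[det (M' ** A) = det (A ** M)] (mod int p)" by (rule mat_cong_det[OF BM])
    then have "int p dvd det M' * det A \<longleftrightarrow> int p dvd det A * det M"
      unfolding det_mul by (rule cong_dvd_iff)
    moreover have "\<not> int p dvd det A" by (rule not_dvd_det_if_inverse_mod[OF p AB(2)])
    ultimately have det': "\<not> int p dvd det M'"
      using det p prime_dvd_mult_iff[of "int p"] by auto
    show ?thesis
      using P.n_star_eq_clique_number(1)[OF det] P'.n_star_eq_clique_number[OF det']
        residue_clique_sizes_intertwined[OF GN P.HG P.GH P.not_nilpotent[OF det]]
      unfolding \<mu>_def \<mu>'_def id transpose_mat by simp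
  qed
qed

theorem theorem1p7:
  fixes p :: nat
    and M M' :: "int ^ 'n ^ 'n"
    and D D' :: "(int ^ 'n) set"
  assumes "prime p"
    and "expanding (real_mat M)" and "expanding (real_mat M')"
    and "finite D" and "D \<noteq> {}" and "finite D'" and "D' \<noteq> {}"
    and "conjugate_GL p M D M' D'"
    and "mask_zeros (real_vec ` D') \<subseteq> E_grid_punctured p \<or>
         mask_zeros (real_vec ` D) \<subseteq> E_grid_punctured p"
  shows "(has_infinite_orthogonal_exponentials (self_affine_measure (real_mat M) (real_vec ` D)) \<longleftrightarrow>
          has_infinite_orthogonal_exponentials (self_affine_measure (real_mat M') (real_vec ` D')))
       \<and> (\<not> int p dvd det M \<longrightarrow>
            n_star (self_affine_measure (real_mat M) (real_vec ` D)) =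
              n_star (self_affine_measure (real_mat M') (real_vec ` D')) \<and>
            n_star (self_affine_measure (real_mat M') (real_vec ` D')) \<le> enat (p ^ CARD('n)))"
proof -
  have grid: "mask_zeros (real_vec ` D') \<subseteq> E_grid p \<or> mask_zeros (real_vec ` D) \<subseteq> E_grid p"
    using assms(9) unfolding E_grid_punctured_def by blast
  have p_pos: "p > 0" using assms(1) by (rule prime_gt_0_nat)
  obtain A B where A: "invertible_mod p A" and AB: "mat_cong p (A ** B) (mat 1)"
    and cases: "M' = A ** M ** B \<and> D = (\<lambda>d. B *v d) ` D' \<or> M' = A ** M ** B \<and> D' = (\<lambda>d. A *v d) ` D"
    using assms(8) unfolding conjugate_GL_def by blast
  have BA: "mat_cong p (B ** A) (mat 1)"
  proof -
    obtain C where AC: "mat_cong p (A ** C) (mat 1)" and CA: "mat_cong p (C ** A) (mat 1)"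
      using A by (auto simp: invertible_mod_def)
    have "mat_cong p ((C ** A) ** B) (mat 1 ** B)" by (rule mat_cong_mult[OF CA mat_cong_refl])
    moreover have "mat_cong p (C ** (A ** B)) (C ** mat 1)" by (rule mat_cong_mult[OF mat_cong_refl AB])
    ultimately have "mat_cong p B C"
      using mat_cong_sym mat_cong_trans by (metis matrix_mul_assoc matrix_mul_lid matrix_mul_rid)
    then have "mat_cong p (B ** A) (C ** A)" by (rule mat_cong_mult[OF _ mat_cong_refl])
    then show ?thesis using CA by (rule mat_cong_trans)
  qed
  have det: "det A \<noteq> 0" "det B \<noteq> 0" "\<not> int p dvd det A" "\<not> int p dvd det B"
    using not_dvd_det_if_inverse_mod[OF assms(1) BA] not_dvd_det_if_inverse_mod[OF assms(1) AB]
    by auto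
  from cases show ?thesis
  proof
    assume i: "M' = A ** M ** B \<and> D = (\<lambda>d. B *v d) ` D'"
    have "mask_zeros (real_vec ` D') \<subseteq> E_grid p"
      using grid mask_zeros_subset_grid_transfer[OF p_pos det(2), of D'] i by blast
    moreover have "mat_cong p M' (A ** M ** B)" using i by simp
    ultimately show ?thesis
      using conjugate_measures[OF assms(1-3,6,7) AB BA] i by simp
  next
    assume ii: "M' = A ** M ** B \<and> D' = (\<lambda>d. A *v d) ` D"
    have zeros: "mask_zeros (real_vec ` D) \<subseteq> E_grid p"
      using grid mask_zeros_subset_grid_transfer[OF p_pos det(1), of D] ii by blast
    have M: "mat_cong p M (B ** M' ** A)"
    proof -
      have "B ** M' ** A = (B ** A) ** (M ** (B ** A))" using ii by (simp add: matrix_mul_assoc)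
      also have "mat_cong p \<dots> (mat 1 ** (M ** mat 1))"
        by (intro mat_cong_mult BA mat_cong_refl)
      finally show ?thesis by (simp add: mat_cong_sym)
    qed
    have "\<not> int p dvd det M'" if "\<not> int p dvd det M"
      using ii that det(3,4) prime_dvd_mult_iff[of "int p"] assms(1) by (auto simp: det_mul)
    then show ?thesis
      using conjugate_measures[OF assms(1,3,2,4,5) BA AB M zeros] ii by auto
  qed
qed

end
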